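(* Let $(x,u)\in\mathcal S$ with mode insertion gradient $d$. If $\theta<0$, and $f_\sigma$, $\sigma\in\{1,\dots,N\}$, and $\ell$ are (real) analytic in $x$, then $-d$ is a descent direction; that is, there is $\delta\gamma>0$ such that for each $\gamma\in(\gamma_0,\gamma_0+\delta\gamma)$, $J(\gamma)<J(0)$, where $J(\gamma):=J(\mathcal P(x,u-\gamma d))$.
   Context: Setting. Fix $T>0$, $x_0\in\mathbb R^n$, modes $f_1,\dots,f_N:\mathbb R^n\to\mathbb R^n$ and a running cost $\ell:\mathbb R^n\to\mathbb R$. Standing assumption: each $f_i$ and $\ell$ are $C^2$ on $\mathbb R^n$ with $\|D^2f_i(x)\|\le K_2$, $\|D^2\ell(x)\|\le\overline K_2$ for all $x$, for some constants. A switching control is a piecewise constant $u=[u_1,\dots,u_N]^T$ on $[0,T]$ with $u_i(t)\in\{0,1\}$ and $\sum_iu_i(t)=1$ for a.e. $t$; its switching times are the times in $(0,T)$ at which it changes value (it is taken right-continuous). $u$ is non-chattering if for some $\delta t>0$ all adjacent switching times differ by more than $\delta t$; $\Omega$ is the set of non-chattering switching controls. $\mathcal X$, $\mathcal U$ are the Lebesgue integrable functions from $[0,T]$ to $\mathbb R^n$, $\mathbb R^N$. With $F(x,u)=\sum_iu_if_i(x)$, $\mathcal S$ is the set of $(x,u)\in\mathcal X\times\mathcal U$ with $u\in\Omega$ and $\dot x=F(x,u)$, $x(0)=x_0$ (in integral form). The cost is $J(x,u)=\int_0^T\ell(x(\tau))\,d\tau$. The adjoint $\rho$ solves $\dot\rho=-D_1F(x,u)^T\rho-D\ell(x)^T$,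 $\rho(T)=0$. The mode insertion gradient of $J$ at $(x,u)$ is $d=[d_1,\dots,d_N]^T$, $d_a(t)=\rho(t)^T(f_a(x(t))-F(x(t),u(t)))$. Projection. $\mathcal Q_i(\mu(t))=\prod_{j\ne i}1(\mu_i(t)-\mu_j(t))$ with $1(s)=1$ for $s\ge0$, $1(s)=0$ for $s<0$. $\mathcal R\subset\mathcal U$ is the set of $\mu$ with $\mathcal Q(\mu)\in\Omega$. $\mathcal P(\alpha,\mu)=(x,u)$ for $(\alpha,\mu)\in\mathcal X\times\mathcal R$, where $u=\mathcal Q(\mu)$ and $x$ solves $\dot x=F(x,u)$, $x(0)=x_0$. Standing assumption: $d$ is piecewise continuous and for $i\neq j$ the function $d_i-d_j$ has finitely many critical points in $[0,T]$ (points where its derivative vanishes or it is not differentiable); this guarantees $u-\gamma d\in\mathcal R$ for $\gamma>0$. Optimality function. $\theta=\theta(x,u):=\min_{\sigma\in\{1,\dots,N\},\,t\in[0,T]}d_\sigma(t)$ (the lower bound of $d$ over modes and times), and $\gamma_0:=-1/\theta$ when $\theta<0$. *)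

theory Defs
  imports "HOL-Analysis.Analysis"
begin

definition C2_bounded :: "('a::real_normed_vector \<Rightarrow> 'b::real_normed_vector) \<Rightarrow> real \<Rightarrow> bool" where
  "C2_bounded g K \<longleftrightarrow>
     (\<exists>(g' :: 'a \<Rightarrow> 'a \<Rightarrow>\<^sub>L 'b) (g'' :: 'a \<Rightarrow> 'a \<Rightarrow>\<^sub>L 'a \<Rightarrow>\<^sub>L 'b).
        (\<forall>x. (g has_derivative blinfun_apply (g' x)) (at x)) \<and>
        (\<forall>x. (g' has_derivative blinfun_apply (g'' x)) (at x)) \<and>
        continuous_on UNIV g'' \<and>
        (\<forall>x. norm (g'' x) \<le> K))"

(* The sum ranges over all multi-indices k; has_sum is unconditional convergence. *)
definition real_analytic :: "(real^'n \<Rightarrow> 'b::real_normed_vector) \<Rightarrow> bool" where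
  "real_analytic g \<longleftrightarrow>
     (\<forall>c. \<exists>r>0. \<exists>a :: ('n \<Rightarrow> nat) \<Rightarrow> 'b. \<forall>x\<in>ball c r.
        ((\<lambda>k. (\<Prod>i\<in>UNIV. (x $ i - c $ i) ^ k i) *\<^sub>R a k) has_sum g x) UNIV)"

(* Functions on [0,T] are represented by total functions on the reals;
   their values outside [0,T] are never used. *)

definition piecewise_constant :: "real \<Rightarrow> (real \<Rightarrow> 'a) \<Rightarrow> bool" where
  "piecewise_constant T u \<longleftrightarrow>
     (\<exists>P. finite P \<and> (\<forall>a b. {a<..<b} \<subseteq> {0..T} - P \<longrightarrow> u constant_on {a<..<b}))"

definition piecewise_continuous :: "real \<Rightarrow> (real \<Rightarrow> 'a::topological_space) \<Rightarrow> bool" where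
  "piecewise_continuous T g \<longleftrightarrow>
     (\<exists>P. finite P \<and> continuous_on ({0..T} - P) g) \<and>
     (\<forall>t\<in>{0..<T}. \<exists>l. (g \<longlongrightarrow> l) (at_right t)) \<and>
     (\<forall>t\<in>{0<..T}. \<exists>l. (g \<longlongrightarrow> l) (at_left t))"

definition critical_points :: "real \<Rightarrow> (real \<Rightarrow> real) \<Rightarrow> real set" where
  "critical_points T g =
     {t\<in>{0..T}. \<not> g differentiable (at t within {0..T}) \<or>
                (g has_real_derivative 0) (at t within {0..T})}"

definition right_continuous :: "real \<Rightarrow> (real \<Rightarrow> 'a::topological_space) \<Rightarrow> bool" where
  "right_continuous T u \<longleftrightarrow> (\<forall>t\<in>{0..<T}. continuous (at_right t) u)"

(* Switching controls are insensitive to changes at finitely many times: the projection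
   below yields, at times where several components tie, a vector that is not a unit vector.
   Hence right-continuity is not built in here, and a switching time is a jump of the
   right-continuous representative, i.e. a time where the one-sided limits differ. *)

definition switching_control :: "real \<Rightarrow> (real \<Rightarrow> real^'m) \<Rightarrow> bool" where
  "switching_control T u \<longleftrightarrow>
     piecewise_constant T u \<and>
     (AE t in lebesgue. t \<in> {0..T} \<longrightarrow> (\<forall>i. u t $ i \<in> {0, 1}) \<and> (\<Sum>i\<in>UNIV. u t $ i) = 1)"

definition switching_times :: "real \<Rightarrow> (real \<Rightarrow> real^'m) \<Rightarrow> real set" where
  "switching_times T u = {t\<in>{0<..<T}. Lim (at_left t) u \<noteq> Lim (at_right t) u}"

definition non_chattering :: "real \<Rightarrow> (real \<Rightarrow> real^'m) \<Rightarrow> bool" where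
  "non_chattering T u \<longleftrightarrow>
     (\<exists>\<delta>>0. \<forall>s\<in>switching_times T u. \<forall>t\<in>switching_times T u.
        s < t \<and> {s<..<t} \<inter> switching_times T u = {} \<longrightarrow> t - s > \<delta>)"

definition Omega :: "real \<Rightarrow> (real \<Rightarrow> real^'m) set" where
  "Omega T = {u. switching_control T u \<and> non_chattering T u}"

definition vector_field :: "('m \<Rightarrow> real^'n \<Rightarrow> real^'n) \<Rightarrow> real^'n \<Rightarrow> real^'m \<Rightarrow> real^'n" where
  "vector_field f y w = (\<Sum>i\<in>UNIV. w $ i *\<^sub>R f i y)"

definition is_trajectory ::
  "real \<Rightarrow> real^'n \<Rightarrow> ('m \<Rightarrow> real^'n \<Rightarrow> real^'n) \<Rightarrow> (real \<Rightarrow> real^'m) \<Rightarrow> (real \<Rightarrow> real^'n) \<Rightarrow> bool" where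
  "is_trajectory T x0 f u x \<longleftrightarrow>
     (\<lambda>s. vector_field f (x s) (u s)) absolutely_integrable_on {0..T} \<and>
     (\<forall>t\<in>{0..T}. x t = x0 + integral {0..t} (\<lambda>s. vector_field f (x s) (u s)))"

definition feasible_set ::
  "real \<Rightarrow> real^'n \<Rightarrow> ('m \<Rightarrow> real^'n \<Rightarrow> real^'n) \<Rightarrow> ((real \<Rightarrow> real^'n) \<times> (real \<Rightarrow> real^'m)) set" where
  "feasible_set T x0 f =
     {(x, u). x absolutely_integrable_on {0..T} \<and> u absolutely_integrable_on {0..T} \<and>
              u \<in> Omega T \<and> is_trajectory T x0 f u x}"

definition cost :: "real \<Rightarrow> (real^'n \<Rightarrow> real) \<Rightarrow> (real \<Rightarrow> real^'n) \<times> (real \<Rightarrow> real^'m) \<Rightarrow> real" where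
  "cost T l = (\<lambda>(x, u). integral {0..T} (\<lambda>\<tau>. l (x \<tau>)))"

(* Integral form of the terminal value problem with final value 0. The library constant
   adjoint is the transpose of a linear map; for the derivative of l, a linear functional,
   its value at 1 is the gradient. *)
definition is_costate ::
  "real \<Rightarrow> ('m \<Rightarrow> real^'n \<Rightarrow> real^'n) \<Rightarrow> (real^'n \<Rightarrow> real) \<Rightarrow> (real \<Rightarrow> real^'n) \<Rightarrow> (real \<Rightarrow> real^'m)
     \<Rightarrow> (real \<Rightarrow> real^'n) \<Rightarrow> bool" where
  "is_costate T f l x u \<rho> \<longleftrightarrow>
     (let g = (\<lambda>s. adjoint (frechet_derivative (\<lambda>y. vector_field f y (u s)) (at (x s))) (\<rho> s)
                   + adjoint (frechet_derivative l (at (x s))) 1)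
      in g absolutely_integrable_on {0..T} \<and> (\<forall>t\<in>{0..T}. \<rho> t = integral {t..T} g))"

definition mode_insertion_gradient ::
  "('m \<Rightarrow> real^'n \<Rightarrow> real^'n) \<Rightarrow> (real \<Rightarrow> real^'n) \<Rightarrow> (real \<Rightarrow> real^'m) \<Rightarrow> (real \<Rightarrow> real^'n)
     \<Rightarrow> real \<Rightarrow> real^'m" where
  "mode_insertion_gradient f x u \<rho> t =
     (\<chi> a. \<rho> t \<bullet> (f a (x t) - vector_field f (x t) (u t)))"

definition step1 :: "real \<Rightarrow> real" where
  "step1 s = (if s \<ge> 0 then 1 else 0)"

definition Q_proj :: "real^'m \<Rightarrow> real^'m" where
  "Q_proj w = (\<chi> i. \<Prod>j\<in>UNIV - {i}. step1 (w $ i - w $ j))"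

definition R_set :: "real \<Rightarrow> (real \<Rightarrow> real^'m) set" where
  "R_set T = {\<mu>. \<mu> absolutely_integrable_on {0..T} \<and> (\<lambda>t. Q_proj (\<mu> t)) \<in> Omega T}"

(* Trajectories are unique on [0,T] when they exist, so the choice only fixes values outside
   [0,T]. Bounded second derivatives do not rule out finite escape time, so a trajectory
   need not exist for every control. *)
definition P_proj ::
  "real \<Rightarrow> real^'n \<Rightarrow> ('m \<Rightarrow> real^'n \<Rightarrow> real^'n) \<Rightarrow> (real \<Rightarrow> real^'n) \<times> (real \<Rightarrow> real^'m)
     \<Rightarrow> (real \<Rightarrow> real^'n) \<times> (real \<Rightarrow> real^'m)" where
  "P_proj T x0 f = (\<lambda>(\<alpha>, \<mu>). let u = (\<lambda>t. Q_proj (\<mu> t))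
                              in (SOME x. is_trajectory T x0 f u x, u))"

(* An infimum: d is only piecewise continuous, so a minimum need not be attained. *)
definition optimality_function :: "real \<Rightarrow> (real \<Rightarrow> real^'m) \<Rightarrow> real" where
  "optimality_function T d = (INF (\<sigma>, t)\<in>UNIV \<times> {0..T}. d t $ \<sigma>)"

end

theory Submission
  imports Defs
begin

text \<open>
  Write \<open>v \<gamma>\<close> for the projection of \<open>u - \<gamma> d\<close>. At a time at which mode \<open>k\<close> is active one has
  \<open>d k = 0\<close>, so the components of \<open>u - \<gamma> d\<close> are \<open>1\<close> at \<open>k\<close> and \<open>- \<gamma> d a\<close> at the other modes \<open>a\<close>.
  Hence \<open>v \<gamma>\<close> differs from \<open>u\<close> only where some \<open>d a \<le> - 1 / \<gamma>\<close>, and where it switches to mode \<open>a\<close>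
  the first-order change of the cost per unit of time is \<open>d a \<le> - 1 / \<gamma>\<close>. If \<open>m\<close> is the total time
  during which the two controls differ, then the cost changes by at most \<open>- m / \<gamma> + C m\<^sup>2\<close>, which is
  negative as soon as \<open>m\<close> is positive and small.

  The threshold \<open>\<gamma>0 = - 1 / \<theta>\<close> is the value at which \<open>- 1 / \<gamma>\<close> equals the infimum \<open>\<theta>\<close> of \<open>d\<close>. For
  \<open>\<gamma> > \<gamma>0\<close> some \<open>d a\<close> lies below \<open>- 1 / \<gamma>\<close>, by right continuity on a whole interval, so
  \<open>m > 0\<close> (\<open>switched_time_positive\<close>). As \<open>\<gamma>\<close> decreases to \<open>\<gamma>0\<close> the differing times shrink to times
  at which a difference \<open>d a - d k\<close> equals \<open>\<theta>\<close>. By Rolle's theorem a function with finitely many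
  critical points has finite level sets (\<open>finite_level_set\<close>), so \<open>m\<close> tends to \<open>0\<close> by dominated
  convergence (\<open>switched_time_tendsto_0\<close>). The same finiteness, applied to ties between components
  of \<open>u - \<gamma> d\<close>, shows that \<open>v \<gamma>\<close> is a switching control with finitely many switching times
  (\<open>projected_control_step_on\<close>).

  The estimate of the cost (\<open>cost_perturbation\<close>) is a second-order expansion. Gronwall's inequality
  bounds the distance of the two trajectories by a multiple of \<open>m\<close>; integrating the derivative of
  the product of the costate with the difference of the trajectories trades the linear term of the
  cost for the integral of \<open>d a\<close> over the differing times, and all remainders are of order \<open>m\<^sup>2\<close>.
  Since bounded second derivatives allow finite escape time, existence of the perturbed
  trajectory has to be proved too: the modes are truncated outside a ball to make them globally
  Lipschitz, Picard iteration gives a trajectory of the truncated system, and the Gronwall bound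
  keeps it in the ball, where truncation changes nothing (\<open>nearby_trajectory\<close>).
\<close>

section \<open>Step functions of time\<close>

text \<open>All controls are only relevant up to finitely many times. Working with a function that is locally
  constant off a finite set, with the endpoints included in that set, has the effect that a function
  of time and control, continuous in time for each fixed control value, is continuous along the
  control at each remaining time. The set \<open>V\<close> of values is abstract so that a pair
  of controls is again a step function.\<close>

definition step_on :: "real \<Rightarrow> real set \<Rightarrow> 'c set \<Rightarrow> (real \<Rightarrow> 'c) \<Rightarrow> bool" where
  "step_on T P V u \<longleftrightarrow> finite P \<and> {0, T} \<subseteq> P \<and> finite V \<and>
     (\<forall>t\<in>{0..T} - P. \<exists>c\<in>V. \<forall>\<^sub>F s in nhds t. u s = c)"

lemma step_on_value:
  assumes "step_on T P V u" "t \<in> {0..T} - P"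
  shows "u t \<in> V" "\<forall>\<^sub>F s in nhds t. u s = u t"
proof -
  obtain c where c: "c \<in> V" "\<forall>\<^sub>F s in nhds t. u s = c"
    using assms unfolding step_on_def by blast
  from c(2) have "u t = c" by (rule eventually_nhds_x_imp_x)
  with c show "u t \<in> V" "\<forall>\<^sub>F s in nhds t. u s = u t" by auto
qed

lemma step_on_interior:
  assumes "step_on T P V u" "t \<in> {0..T} - P"
  shows "t \<in> {0<..<T}"
  using assms by (auto simp: step_on_def less_le)

lemma step_on_cong:
  assumes u: "step_on T P V u" and eq: "\<And>t. t \<in> {0..T} - P \<Longrightarrow> v t = u t"
  shows "step_on T P V v"
  unfolding step_on_def
proof (intro conjI ballI)
  fix t assume t: "t \<in> {0..T} - P"
  have "finite P" using u by (simp add: step_on_def)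
  then have "open ({0<..<T} - P)" by (intro open_Diff finite_imp_closed) auto
  then have "\<forall>\<^sub>F s in nhds t. s \<in> {0<..<T} - P"
    by (rule eventually_nhds_in_open) (use t step_on_interior[OF u t] in auto)
  with step_on_value(2)[OF u t] have "\<forall>\<^sub>F s in nhds t. v s = u t"
    by eventually_elim (use eq in auto)
  then show "\<exists>c\<in>V. \<forall>\<^sub>F s in nhds t. v s = c"
    using step_on_value(1)[OF u t] by blast
qed (use u in \<open>auto simp: step_on_def\<close>)

lemma step_on_pair:
  assumes "step_on T P V u" "step_on T Q W v"
  shows "step_on T (P \<union> Q) (V \<times> W) (\<lambda>s. (u s, v s))"
  unfolding step_on_def
proof (intro conjI ballI)
  fix t assume t: "t \<in> {0..T} - (P \<union> Q)"
  have "\<forall>\<^sub>F s in nhds t. (u s, v s) = (u t, v t)"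
    using step_on_value(2)[OF assms(1), of t] step_on_value(2)[OF assms(2), of t] t
    by (auto elim: eventually_elim2)
  moreover have "(u t, v t) \<in> V \<times> W"
    using step_on_value(1)[OF assms(1), of t] step_on_value(1)[OF assms(2), of t] t by auto
  ultimately show "\<exists>c\<in>V \<times> W. \<forall>\<^sub>F s in nhds t. (u s, v s) = c" by blast
qed (use assms in \<open>auto simp: step_on_def\<close>)

text \<open>Near a time off the exceptional set the control is frozen, so regularity in \<open>s\<close> for each fixed
  control value passes to the composite; likewise for boundedness and integrability below.\<close>

lemma isCont_along_step:
  fixes H :: "real \<Rightarrow> 'c \<Rightarrow> 'b::topological_space"
  assumes u: "step_on T P V u" and t: "t \<in> {0..T} - P"
    and H: "\<And>c. c \<in> V \<Longrightarrow> continuous_on {0..T} (\<lambda>s. H s c)"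
  shows "isCont (\<lambda>s. H s (u s)) t"
proof -
  have "t \<in> interior {0..T}"
    using step_on_interior[OF u t] by simp
  then have "isCont (\<lambda>s. H s (u t)) t"
    using H[OF step_on_value(1)[OF u t]] continuous_on_interior by blast
  moreover have "\<forall>\<^sub>F s in nhds t. H s (u s) = H s (u t)"
    using step_on_value(2)[OF u t] by eventually_elim simp
  ultimately show ?thesis
    by (simp add: isCont_cong)
qed

lemma bounded_along_step:
  fixes H :: "real \<Rightarrow> 'c \<Rightarrow> 'b::real_normed_vector"
  assumes u: "step_on T P V u"
    and H: "\<And>c. c \<in> V \<Longrightarrow> continuous_on {0..T} (\<lambda>s. H s c)"
  obtains B where "\<And>s c. s \<in> {0..T} \<Longrightarrow> c \<in> V \<Longrightarrow> norm (H s c) \<le> B"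
proof -
  have "finite V" using u by (simp add: step_on_def)
  then have "bounded (\<Union>c\<in>V. (\<lambda>s. H s c) ` {0..T})"
    using H by (intro bounded_UN) (auto intro!: compact_imp_bounded compact_continuous_image)
  then obtain B where "\<forall>z\<in>(\<Union>c\<in>V. (\<lambda>s. H s c) ` {0..T}). norm z \<le> B"
    by (auto simp: bounded_iff)
  then show ?thesis using that[of B] by blast
qed

lemma absolutely_integrable_bounded_continuous_off_finite:
  fixes g :: "real \<Rightarrow> 'b::euclidean_space"
  assumes "finite P" "continuous_on ({0..T} - P) g" "\<And>t. t \<in> {0..T} - P \<Longrightarrow> norm (g t) \<le> B"
  shows "g absolutely_integrable_on {0..T}"
proof -
  let ?S = "{0..T} - P"
  have S: "?S \<in> sets lebesgue"
    using negligible_imp_sets[OF negligible_finite[OF assms(1)]] by (intro sets.Diff) auto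
  have lm: "?S \<in> lmeasurable"
    using S by (intro bounded_set_imp_lmeasurable) (auto intro: bounded_subset[of "{0..T}"])
  have "g absolutely_integrable_on ?S"
    using S lm assms(3)
    by (intro measurable_bounded_by_integrable_imp_absolutely_integrable[where g = "\<lambda>_. B"]
        continuous_imp_measurable_on_sets_lebesgue assms(2) integrable_on_const) auto
  then show ?thesis
    by (rule absolutely_integrable_spike_set)
      (auto intro: negligible_subset[OF negligible_finite[OF assms(1)]])
qed

lemma absolutely_integrable_along_step:
  fixes H :: "real \<Rightarrow> 'c \<Rightarrow> 'b::euclidean_space"
  assumes u: "step_on T P V u"
    and H: "\<And>c. c \<in> V \<Longrightarrow> continuous_on {0..T} (\<lambda>s. H s c)"
  shows "(\<lambda>s. H s (u s)) absolutely_integrable_on {0..T}"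
proof -
  obtain B where B: "\<And>s c. s \<in> {0..T} \<Longrightarrow> c \<in> V \<Longrightarrow> norm (H s c) \<le> B"
    using bounded_along_step[OF u, of H] H by blast
  show ?thesis
  proof (rule absolutely_integrable_bounded_continuous_off_finite)
    show "finite P" using u by (simp add: step_on_def)
    show "continuous_on ({0..T} - P) (\<lambda>s. H s (u s))"
      using isCont_along_step[where H = H, OF u _ H] by (intro continuous_at_imp_continuous_on) blast
    show "norm (H t (u t)) \<le> B" if "t \<in> {0..T} - P" for t
      using B[of t "u t"] step_on_value(1)[OF u that] that by auto
  qed
qed

lemma integral_norm_le_off_finite:
  fixes g :: "real \<Rightarrow> 'b::banach"
  assumes "g integrable_on S" "h integrable_on S" "finite P"
    and le: "\<And>t. t \<in> S - P \<Longrightarrow> norm (g t) \<le> h t"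
  shows "norm (integral S g) \<le> integral S h"
proof -
  have neg: "negligible P" using assms(3) by (rule negligible_finite)
  let ?g = "\<lambda>t. if t \<in> P then 0 else g t" and ?h = "\<lambda>t. if t \<in> P then 0 else h t"
  have "integral S g = integral S ?g" "integral S h = integral S ?h"
    by (auto intro: integral_spike[OF neg])
  moreover have "?g integrable_on S" "?h integrable_on S"
    using assms(1,2) by (auto intro: integrable_spike[OF _ neg])
  moreover have "norm (?g t) \<le> ?h t" if "t \<in> S" for t using le that by auto
  ultimately show ?thesis using integral_norm_bound_integral[of ?g S ?h] by simp
qed

lemma integral_le_off_finite:
  fixes g h :: "real \<Rightarrow> real"
  assumes "g integrable_on S" "h integrable_on S" "finite P"
    and le: "\<And>t. t \<in> S - P \<Longrightarrow> g t \<le> h t"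
  shows "integral S g \<le> integral S h"
proof -
  have neg: "negligible P" using assms(3) by (rule negligible_finite)
  let ?g = "\<lambda>t. if t \<in> P then h t else g t"
  have "integral S g = integral S ?g"
    by (auto intro: integral_spike[OF neg])
  moreover have "?g integrable_on S"
    using assms(1) by (auto intro: integrable_spike[OF _ neg])
  ultimately show ?thesis using integral_le[of ?g S h] assms(2) le by auto
qed

text \<open>Integrands along a step function are continuous off a finite set only, hence the fundamental
  theorem is needed at single interior points.\<close>

lemma integral_has_vector_derivative_at_continuity:
  fixes g :: "real \<Rightarrow> 'b::banach"
  assumes "g integrable_on {0..T}" "t \<in> {0<..<T}" "isCont g t"
  shows "((\<lambda>s. integral {0..s} g) has_vector_derivative g t) (at t)"
proof -
  have "((\<lambda>s. integral {0..s} g) has_vector_derivative g t) (at t within ({0..T} - {}))"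
    using assms by (intro integral_has_vector_derivative_continuous_at)
      (auto intro: continuous_at_imp_continuous_at_within)
  moreover have "at t within {0..T} = at t"
    using assms(2) by (intro at_within_interior) simp
  ultimately show ?thesis by simp
qed

lemma bounded_on_compact_interval:
  fixes x :: "real \<Rightarrow> 'b::real_normed_vector"
  assumes "continuous_on {0..T} x"
  obtains R where "0 \<le> R" "\<And>t. t \<in> {0..T} \<Longrightarrow> norm (x t) \<le> R"
proof -
  have "bounded (x ` {0..T})"
    using assms by (intro compact_imp_bounded compact_continuous_image) auto
  then obtain R where "\<forall>z\<in>x ` {0..T}. norm z \<le> R" by (auto simp: bounded_iff)
  then show ?thesis using that[of "\<bar>R\<bar>"] by force
qed

text \<open>A right-continuous step function takes values in the discrete set \<open>V\<close> even at its exceptional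
  times, because right limits of points of a finite set stay in the set and are attained.\<close>

lemma right_continuous_step_on:
  fixes u :: "real \<Rightarrow> 'b::t1_space"
  assumes u: "step_on T P V u" and rc: "right_continuous T u" and t: "t \<in> {0..<T}"
  shows "u t \<in> V" "\<forall>\<^sub>F s in at_right t. u s = u t"
proof -
  have finV: "finite V" and finP: "finite P" using u by (auto simp: step_on_def)
  have lim: "(u \<longlongrightarrow> u t) (at_right t)"
    using rc t by (simp add: right_continuous_def continuous_within)
  have "\<forall>\<^sub>F s in at_right t. s \<in> {t<..<T}"
    using t by (intro eventually_at_right_real) auto
  moreover have "\<forall>\<^sub>F s in at_right t. s \<notin> P - {t}"
  proof -
    have "\<forall>\<^sub>F s in nhds t. s \<in> - (P - {t})"
      by (rule eventually_nhds_in_open[OF open_Compl[OF finite_imp_closed[OF finite_Diff[OF finP]]]]) simp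
    then show ?thesis by (auto simp: eventually_at_filter elim: eventually_mono)
  qed
  ultimately have inV: "\<forall>\<^sub>F s in at_right t. u s \<in> V"
    by eventually_elim (use t step_on_value(1)[OF u] in auto)
  have "\<forall>\<^sub>F s in at_right t. u s \<in> - (V - {u t})"
    by (rule topological_tendstoD[OF lim open_Compl[OF finite_imp_closed[OF finite_Diff[OF finV]]]]) simp
  with inV show ev: "\<forall>\<^sub>F s in at_right t. u s = u t" by eventually_elim auto
  from inV ev have "\<forall>\<^sub>F s in at_right t. u t \<in> V" by eventually_elim simp
  then show "u t \<in> V" by (simp add: trivial_limit_at_right_real)
qed

section \<open>Gronwall inequality and Picard iteration\<close>

text \<open>The function \<open>(c + L \<integral> \<phi>) exp (- L t)\<close> has nonpositive derivative.\<close>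

lemma gronwall:
  fixes \<phi> :: "real \<Rightarrow> real"
  assumes "0 \<le> L" "continuous_on {0..T} \<phi>"
    and le: "\<And>t. t \<in> {0..T} \<Longrightarrow> \<phi> t \<le> c + L * integral {0..t} \<phi>"
    and t: "t \<in> {0..T}"
  shows "\<phi> t \<le> c * exp (L * t)"
proof -
  define h where "h s = (c + L * integral {0..s} \<phi>) * exp (- L * s)" for s
  have int: "\<phi> integrable_on {0..T}" using assms(2) by (rule integrable_continuous_real)
  have "h t \<le> h 0"
  proof (cases "t = 0")
    case False
    show ?thesis
    proof (rule DERIV_nonpos_imp_decreasing_open[where f = h])
      show "0 \<le> t" using t by simp
      show "continuous_on {0..t} h"
        unfolding h_def using int t
        by (intro continuous_intros indefinite_integral_continuous_1
            integrable_on_subinterval[OF int]) auto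
      fix s assume s: "0 < s" "s < t"
      then have "s \<in> interior {0..T}" using t by simp
      then have "isCont \<phi> s" using assms(2) continuous_on_interior by blast
      then have d: "((\<lambda>s. integral {0..s} \<phi>) has_real_derivative \<phi> s) (at s)"
        using integral_has_vector_derivative_at_continuity[OF int, of s] s t
        by (simp add: has_real_derivative_iff_has_vector_derivative)
      have "(h has_real_derivative
          (L * (\<phi> s - (c + L * integral {0..s} \<phi>))) * exp (- L * s)) (at s)"
        unfolding h_def by (auto intro!: derivative_eq_intros d simp: algebra_simps)
      moreover have "(L * (\<phi> s - (c + L * integral {0..s} \<phi>))) * exp (- L * s) \<le> 0"
        using le[of s] s t assms(1)
        by (intro mult_nonpos_nonneg mult_nonneg_nonpos) auto
      ultimately show "\<exists>y. (h has_real_derivative y) (at s) \<and> y \<le> 0" by blast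
    qed
  qed simp
  then have "c + L * integral {0..t} \<phi> \<le> c * exp (L * t)"
    by (simp add: h_def exp_minus field_simps)
  with le[OF t] show ?thesis by simp
qed

text \<open>In the variable \<open>z t = exp (- 2 L t) y t\<close> the integral operator becomes a contraction with factor
  \<open>1/2\<close> for the supremum norm over the whole interval, so a single application of Banach's fixed
  point theorem covers \<open>[0, T]\<close>. Functions on \<open>[0, T]\<close> are extended to the real line by clamping
  their argument.\<close>

lemma picard_existence:
  fixes G :: "real \<Rightarrow> 'a::euclidean_space \<Rightarrow> 'a"
  assumes "0 \<le> T" "0 < L"
    and lip: "\<And>s a b. s \<in> {0..T} - P \<Longrightarrow> norm (G s a - G s b) \<le> L * norm (a - b)"
    and P: "finite P"
    and int: "\<And>y. continuous_on {0..T} y \<Longrightarrow> (\<lambda>s. G s (y s)) integrable_on {0..T}"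
  shows "\<exists>y. continuous_on {0..T} y \<and>
    (\<forall>t\<in>{0..T}. y t = x0 + integral {0..t} (\<lambda>s. G s (y s)))"
proof -
  define cl where "cl t = max 0 (min T t)" for t :: real
  have cl: "cl t \<in> {0..T}" for t using assms(1) by (auto simp: cl_def)
  have cl_id: "cl t = t" if "t \<in> {0..T}" for t using that by (auto simp: cl_def)
  have cl_cont: "continuous_on UNIV cl" unfolding cl_def by (intro continuous_intros)
  define E where "E z s = G s (exp (2 * L * s) *\<^sub>R z s)" for z :: "real \<Rightarrow> 'a" and s
  \<comment> \<open>the integral operator in the rescaled variable\<close>
  define \<Psi> where "\<Psi> z t = exp (- 2 * L * t) *\<^sub>R (x0 + integral {0..t} (E z))" for z t
  define \<Phi> where "\<Phi> z = Bcontfun (\<lambda>t. \<Psi> (apply_bcontfun z) (cl t))" for z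
  have E_int: "E z integrable_on {0..t}" if "continuous_on {0..T} z" "t \<in> {0..T}" for z t
  proof -
    have "E z integrable_on {0..T}"
      unfolding E_def using that(1) by (intro int continuous_intros)
    then show ?thesis by (rule integrable_on_subinterval) (use that in auto)
  qed
  have z_cont: "continuous_on S (apply_bcontfun z)" for z :: "real \<Rightarrow>\<^sub>C 'a" and S
    by (intro continuous_on_apply_bcontfun continuous_on_id)
  have \<Psi>_cont: "continuous_on {0..T} (\<Psi> (apply_bcontfun z))" for z
    unfolding \<Psi>_def using assms(1)
    by (intro continuous_intros indefinite_integral_continuous_1 E_int z_cont) auto
  have \<Phi>_apply: "apply_bcontfun (\<Phi> z) t = \<Psi> (apply_bcontfun z) (cl t)" for z t
  proof -
    have "continuous_on UNIV (\<lambda>t. \<Psi> (apply_bcontfun z) (cl t))"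
      by (rule continuous_on_compose2[OF \<Psi>_cont cl_cont]) (use cl in auto)
    moreover have "bounded (range (\<lambda>t. \<Psi> (apply_bcontfun z) (cl t)))"
      by (rule bounded_subset[OF compact_imp_bounded[OF compact_continuous_image[OF \<Psi>_cont]]])
        (use cl in auto)
    ultimately show ?thesis unfolding \<Phi>_def
      by (subst Bcontfun_inverse) (auto simp: bcontfun_def)
  qed
  have contr: "dist (\<Phi> z) (\<Phi> w) \<le> 1/2 * dist z w" for z w
  proof (rule dist_bound)
    fix t
    define \<tau> where "\<tau> = cl t"
    have \<tau>: "\<tau> \<in> {0..T}" using cl by (simp add: \<tau>_def)
    let ?z = "apply_bcontfun z" and ?w = "apply_bcontfun w"
    let ?b = "\<lambda>s. L * dist z w * exp (2 * L * s)"
    have b_int: "(?b has_integral (dist z w / 2 * exp (2 * L * \<tau>) - dist z w / 2 * exp (2 * L * 0))) {0..\<tau>}"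
      using \<tau> \<open>0 < L\<close>
      by (intro fundamental_theorem_of_calculus)
        (auto simp: has_real_derivative_iff_has_vector_derivative[symmetric]
          intro!: derivative_eq_intros)
    have "norm (integral {0..\<tau>} (\<lambda>s. E ?z s - E ?w s)) \<le> integral {0..\<tau>} ?b"
    proof (rule integral_norm_le_off_finite[OF _ _ P])
      show "(\<lambda>s. E ?z s - E ?w s) integrable_on {0..\<tau>}"
        using \<tau> by (intro integrable_diff E_int z_cont) auto
      show "?b integrable_on {0..\<tau>}" using b_int by blast
      fix s assume s: "s \<in> {0..\<tau>} - P"
      then have "norm (E ?z s - E ?w s) \<le> L * (exp (2 * L * s) * dist (?z s) (?w s))"
        unfolding E_def using \<tau> lip[of s "exp (2 * L * s) *\<^sub>R ?z s" "exp (2 * L * s) *\<^sub>R ?w s"]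
        by (simp add: dist_norm flip: scaleR_diff_right)
      also have "\<dots> \<le> L * (exp (2 * L * s) * dist z w)"
        using \<open>0 < L\<close> by (intro mult_left_mono dist_bounded) auto
      finally show "norm (E ?z s - E ?w s) \<le> L * dist z w * exp (2 * L * s)"
        by (simp add: mult_ac)
    qed
    also have "\<dots> \<le> dist z w / 2 * exp (2 * L * \<tau>)"
      using integral_unique[OF b_int] by simp
    finally have *: "norm (integral {0..\<tau>} (\<lambda>s. E ?z s - E ?w s)) \<le> dist z w / 2 * exp (2 * L * \<tau>)" .
    have "dist (\<Psi> ?z \<tau>) (\<Psi> ?w \<tau>) = exp (- 2 * L * \<tau>) * norm (integral {0..\<tau>} (\<lambda>s. E ?z s - E ?w s))"
      using E_int[OF z_cont \<tau>]
      by (simp add: \<Psi>_def dist_norm integral_diff flip: scaleR_diff_right)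
    also have "\<dots> \<le> exp (- 2 * L * \<tau>) * (dist z w / 2 * exp (2 * L * \<tau>))"
      using * by (rule mult_left_mono) simp
    also have "\<dots> = 1/2 * dist z w" by (simp add: exp_minus)
    finally show "dist (apply_bcontfun (\<Phi> z) t) (apply_bcontfun (\<Phi> w) t) \<le> 1/2 * dist z w"
      by (simp add: \<Phi>_apply \<tau>_def)
  qed
  obtain z where z: "\<Phi> z = z" using banach_fix_type[of "1/2" \<Phi>] contr by auto
  define y where "y t = exp (2 * L * t) *\<^sub>R apply_bcontfun z t" for t
  have "y t = x0 + integral {0..t} (\<lambda>s. G s (y s))" if "t \<in> {0..T}" for t
  proof -
    have "apply_bcontfun z t = \<Psi> (apply_bcontfun z) t"
      using \<Phi>_apply[of z t] z cl_id[OF that] by simp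
    then have "y t = exp (2 * L * t) *\<^sub>R \<Psi> (apply_bcontfun z) t" by (simp add: y_def)
    also have "\<dots> = x0 + integral {0..t} (E (apply_bcontfun z))"
      by (simp add: \<Psi>_def exp_minus)
    finally show ?thesis by (simp add: E_def[abs_def] y_def[abs_def])
  qed
  moreover have "continuous_on {0..T} y"
    unfolding y_def by (intro continuous_intros z_cont)
  ultimately show ?thesis by blast
qed

section \<open>Trajectories of switched systems\<close>

abbreviation modes :: "(real^'m) set" where
  "modes \<equiv> range (\<lambda>k. axis k 1)"

lemma vector_field_axis [simp]: "vector_field f y (axis k 1) = f k y"
proof -
  have "axis k (1::real) $ i *\<^sub>R f i y = (if i = k then f i y else 0)" for i
    by (simp add: axis_def)
  then show ?thesis unfolding vector_field_def by simp
qed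

text \<open>The measure of the set of times at which two controls differ: the small parameter of all the
  estimates.\<close>

definition switched_time :: "real \<Rightarrow> (real \<Rightarrow> 'c) \<Rightarrow> (real \<Rightarrow> 'c) \<Rightarrow> real" where
  "switched_time T u v = integral {0..T} (\<lambda>s. of_bool (u s \<noteq> v s))"

lemma switched_integrable:
  assumes "step_on T P V u" "step_on T Q W v"
  shows "(\<lambda>s. of_bool (u s \<noteq> v s) :: real) integrable_on {0..T}"
  using absolutely_integrable_along_step[OF step_on_pair[OF assms],
      of "\<lambda>_ c. of_bool (fst c \<noteq> snd c) :: real"]
  by (auto intro: set_lebesgue_integral_eq_integral)

lemma switched_time_nonneg: "0 \<le> switched_time T u v"
  unfolding switched_time_def
  by (cases "(\<lambda>s. of_bool (u s \<noteq> v s) :: real) integrable_on {0..T}")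
    (auto intro: integral_nonneg simp: not_integrable_integral)

lemma switched_time_positive:
  assumes u: "step_on T P V u" and v: "step_on T Q W v"
    and "0 \<le> a" "a < b" "b \<le> T" and ne: "\<And>t. t \<in> {a<..<b} - P \<Longrightarrow> u t \<noteq> v t"
  shows "0 < switched_time T u v"
proof -
  let ?w = "\<lambda>t. of_bool (u t \<noteq> v t) :: real"
  have w: "?w integrable_on {0..T}" by (rule switched_integrable[OF u v])
  have wab: "?w integrable_on {a..b}"
    by (rule integrable_on_subinterval[OF w]) (use assms in auto)
  have fin: "finite (insert a (insert b P))" using u by (simp add: step_on_def)
  have "b - a = integral {a..b} (\<lambda>_. 1)" using \<open>a < b\<close> by simp
  also have "\<dots> \<le> integral {a..b} ?w"
    by (rule integral_le_off_finite[OF integrable_const_ivl wab fin]) (use ne in auto)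
  also have "\<dots> \<le> switched_time T u v"
    unfolding switched_time_def by (rule integral_subset_le[OF _ wab w]) (use assms in auto)
  finally show ?thesis using \<open>a < b\<close> by simp
qed

lemma trajectory_integrable:
  assumes "is_trajectory T x0 f u x" "t \<le> T"
  shows "(\<lambda>s. vector_field f (x s) (u s)) integrable_on {0..t}"
proof -
  have "(\<lambda>s. vector_field f (x s) (u s)) integrable_on {0..T}"
    using assms unfolding is_trajectory_def by (blast intro: set_lebesgue_integral_eq_integral)
  then show ?thesis by (rule integrable_on_subinterval) (use assms(2) in auto)
qed

lemma trajectory_continuous:
  assumes "is_trajectory T x0 f u x"
  shows "continuous_on {0..T} x"
proof -
  have "continuous_on {0..T} (\<lambda>t. x0 + integral {0..t} (\<lambda>s. vector_field f (x s) (u s)))"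
    using trajectory_integrable[OF assms]
    by (intro continuous_intros indefinite_integral_continuous_1) auto
  then show ?thesis
    using assms unfolding is_trajectory_def by (subst continuous_on_cong) auto
qed

lemma is_trajectory_cong:
  assumes "\<And>s k. s \<in> {0..T} \<Longrightarrow> f k (x s) = g k (x s)"
  shows "is_trajectory T x0 f u x \<longleftrightarrow> is_trajectory T x0 g u x"
proof -
  have eq: "vector_field f (x s) (u s) = vector_field g (x s) (u s)" if "s \<in> {0..T}" for s
    using assms[OF that] by (simp add: vector_field_def)
  have "(\<lambda>s. vector_field f (x s) (u s)) absolutely_integrable_on {0..T} \<longleftrightarrow>
      (\<lambda>s. vector_field g (x s) (u s)) absolutely_integrable_on {0..T}"
    by (rule set_integrable_cong) (auto simp: eq)
  moreover have "integral {0..t} (\<lambda>s. vector_field f (x s) (u s)) =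
      integral {0..t} (\<lambda>s. vector_field g (x s) (u s))" if "t \<in> {0..T}" for t
    using that by (intro integral_cong eq) auto
  ultimately show ?thesis unfolding is_trajectory_def by auto
qed

lemma is_trajectory_cong_control:
  assumes x: "is_trajectory T x0 f u x" and "finite P"
    and eq: "\<And>t. t \<in> {0..T} - P \<Longrightarrow> v t = u t"
  shows "is_trajectory T x0 f v x"
proof -
  have neg: "negligible P" using assms(2) by (rule negligible_finite)
  have "(\<lambda>s. vector_field f (x s) (v s)) absolutely_integrable_on {0..T}"
  proof (rule absolutely_integrable_spike[OF _ neg])
    show "(\<lambda>s. vector_field f (x s) (u s)) absolutely_integrable_on {0..T}"
      using x by (simp add: is_trajectory_def)
  qed (simp add: eq)
  moreover have "integral {0..t} (\<lambda>s. vector_field f (x s) (u s)) =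
      integral {0..t} (\<lambda>s. vector_field f (x s) (v s))" if "t \<in> {0..T}" for t
    by (rule integral_spike[OF neg]) (use eq that in auto)
  ultimately show ?thesis using x unfolding is_trajectory_def by simp
qed

lemma cost_cong:
  assumes "\<And>t. t \<in> {0..T} \<Longrightarrow> z t = y t"
  shows "cost T l (z, w) = cost T l (y, w')"
  using assms unfolding cost_def by (auto intro: integral_cong)

lemma field_absolutely_integrable:
  assumes u: "step_on T P modes u" and g: "\<And>k. continuous_on UNIV (g k)"
    and y: "continuous_on {0..T} y"
  shows "(\<lambda>s. vector_field g (y s) (u s)) absolutely_integrable_on {0..T}"
proof (rule absolutely_integrable_along_step[OF u])
  fix c :: "real^'a" assume "c \<in> modes"
  then show "continuous_on {0..T} (\<lambda>s. vector_field g (y s) c)"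
    using continuous_on_compose2[OF g y] by auto
qed

lemma trajectory_has_derivative:
  fixes f :: "'m::finite \<Rightarrow> real^'n \<Rightarrow> real^'n"
  assumes u: "step_on T P modes u" and f: "\<And>k. continuous_on UNIV (f k)"
    and x: "is_trajectory T x0 f u x" and t: "t \<in> {0..T} - P"
  shows "(x has_vector_derivative vector_field f (x t) (u t)) (at t)"
proof -
  let ?F = "\<lambda>s. vector_field f (x s) (u s)"
  have tT: "t \<in> {0<..<T}" by (rule step_on_interior[OF u t])
  have "isCont ?F t"
  proof (rule isCont_along_step[OF u t])
    fix c :: "real^'m" assume "c \<in> modes"
    then show "continuous_on {0..T} (\<lambda>s. vector_field f (x s) c)"
      using continuous_on_compose2[OF f trajectory_continuous[OF x]] by auto
  qed
  then have "((\<lambda>s. x0 + integral {0..s} ?F) has_vector_derivative 0 + ?F t) (at t)"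
    by (intro has_vector_derivative_add has_vector_derivative_const
        integral_has_vector_derivative_at_continuity[of _ T] trajectory_integrable[OF x] tT order_refl)
  moreover have "x s = x0 + integral {0..s} ?F" if "s \<in> {0<..<T}" for s
    using x that by (auto simp: is_trajectory_def)
  ultimately show ?thesis
    using has_vector_derivative_transform_within_open[OF _ open_greaterThanLessThan tT]
    by (metis (no_types, lifting) add_0)
qed

text \<open>The difference of the trajectories is the integral of a term that is Lipschitz in the difference
  and of a term of size \<open>2 M\<close> that lives on the times at which the controls differ; Gronwall's
  inequality turns this into a bound linear in the switched time. For equal controls it is
  uniqueness.\<close>

lemma trajectory_perturbation:
  fixes g :: "'m::finite \<Rightarrow> real^'n \<Rightarrow> real^'n"
  assumes u: "step_on T P modes u" and v: "step_on T Q modes v"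
    and "0 \<le> L" and lip: "\<And>k a b. norm (g k a - g k b) \<le> L * norm (a - b)"
    and x: "is_trajectory T x0 g u x" and y: "is_trajectory T x0 g v y"
    and M: "\<And>k s. s \<in> {0..T} \<Longrightarrow> norm (g k (x s)) \<le> M"
    and t: "t \<in> {0..T}"
  shows "norm (y t - x t) \<le> 2 * M * switched_time T u v * exp (L * T)"
proof -
  define \<phi> where "\<phi> s = norm (y s - x s)" for s
  define w where "w s = (of_bool (u s \<noteq> v s) :: real)" for s
  have xy: "continuous_on {0..T} x" "continuous_on {0..T} y"
    using x y trajectory_continuous by blast+
  have \<phi>: "continuous_on {0..T} \<phi>" unfolding \<phi>_def by (intro continuous_intros xy)
  have w: "w integrable_on {0..T}"
    unfolding w_def[abs_def] by (rule switched_integrable[OF u v])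
  have fin: "finite (P \<union> Q)" using u v by (simp add: step_on_def)
  have "0 \<le> M" using M[OF t] norm_ge_zero order_trans by blast
  have "\<phi> r \<le> 2 * M * switched_time T u v + L * integral {0..r} \<phi>" if r: "r \<in> {0..T}" for r
  proof -
    have \<phi>r: "\<phi> integrable_on {0..r}" and wr: "w integrable_on {0..r}"
      using integrable_on_subinterval[OF integrable_continuous_real[OF \<phi>]]
        integrable_on_subinterval[OF w] r by auto
    have "y r - x r = integral {0..r} (\<lambda>s. vector_field g (y s) (v s) - vector_field g (x s) (u s))"
      using x y r trajectory_integrable[OF x, of r] trajectory_integrable[OF y, of r]
      by (simp add: is_trajectory_def integral_diff)
    then have "\<phi> r = norm (integral {0..r}
        (\<lambda>s. vector_field g (y s) (v s) - vector_field g (x s) (u s)))"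
      by (simp add: \<phi>_def)
    also have "\<dots> \<le> integral {0..r} (\<lambda>s. L * \<phi> s + 2 * M * w s)"
    proof (rule integral_norm_le_off_finite[OF _ _ fin])
      show "(\<lambda>s. vector_field g (y s) (v s) - vector_field g (x s) (u s)) integrable_on {0..r}"
        using r by (intro integrable_diff trajectory_integrable[OF x] trajectory_integrable[OF y]) auto
      show "(\<lambda>s. L * \<phi> s + 2 * M * w s) integrable_on {0..r}"
        by (intro integrable_add integrable_on_mult_right \<phi>r wr)
      fix s assume s: "s \<in> {0..r} - (P \<union> Q)"
      then have sT: "s \<in> {0..T}" using r by auto
      obtain a k where a: "v s = axis a 1" and k: "u s = axis k 1"
        using step_on_value(1)[OF u, of s] step_on_value(1)[OF v, of s] s sT by auto
      show "norm (vector_field g (y s) (v s) - vector_field g (x s) (u s)) \<le> L * \<phi> s + 2 * M * w s"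
      proof (cases "u s = v s")
        case True
        then show ?thesis using lip[of a "y s" "x s"] a by (simp add: w_def \<phi>_def)
      next
        case False
        have "norm (g a (y s) - g k (x s)) \<le> norm (g a (y s) - g a (x s)) + norm (g a (x s)) + norm (g k (x s))"
          using norm_triangle_ineq[of "g a (y s) - g a (x s)" "g a (x s)"]
            norm_triangle_ineq4[of "g a (y s)" "g k (x s)"] by simp
        then show ?thesis
          using lip[of a "y s" "x s"] M[OF sT, of a] M[OF sT, of k] False
          by (simp add: w_def \<phi>_def a k)
      qed
    qed
    also have "\<dots> = L * integral {0..r} \<phi> + 2 * M * integral {0..r} w"
      using integral_add[OF integrable_on_mult_right[OF \<phi>r, of L] integrable_on_mult_right[OF wr, of "2 * M"]]
      by (simp add: mult.assoc)
    also have "integral {0..r} w \<le> switched_time T u v"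
      unfolding switched_time_def w_def[abs_def, symmetric]
      using r wr w by (intro integral_subset_le) (auto simp: w_def)
    finally show ?thesis using \<open>0 \<le> M\<close> by (simp add: mult_left_mono)
  qed
  then have "\<phi> t \<le> 2 * M * switched_time T u v * exp (L * t)"
    by (rule gronwall[OF \<open>0 \<le> L\<close> \<phi> _ t])
  also have "\<dots> \<le> 2 * M * switched_time T u v * exp (L * T)"
    using t \<open>0 \<le> L\<close> \<open>0 \<le> M\<close> switched_time_nonneg[of T u v]
    by (intro mult_left_mono) (auto intro: mult_left_mono)
  finally show ?thesis by (simp add: \<phi>_def)
qed

lemma trajectory_exists_lipschitz:
  fixes g :: "'m::finite \<Rightarrow> real^'n \<Rightarrow> real^'n"
  assumes "0 \<le> T" and u: "step_on T P modes u"
    and "0 \<le> L" and lip: "\<And>k a b. norm (g k a - g k b) \<le> L * norm (a - b)"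
  shows "\<exists>x. is_trajectory T x0 g u x"
proof -
  have cont: "continuous_on UNIV (g k)" for k
    by (rule lipschitz_on_continuous_on[of L])
      (use lip \<open>0 \<le> L\<close> in \<open>auto simp: lipschitz_on_def dist_norm\<close>)
  have "\<exists>y. continuous_on {0..T} y \<and>
    (\<forall>t\<in>{0..T}. y t = x0 + integral {0..t} (\<lambda>s. vector_field g (y s) (u s)))"
  proof (rule picard_existence[where P = P and L = "L + 1"])
    fix s a b assume "s \<in> {0..T} - P"
    then obtain k where "u s = axis k 1" using step_on_value(1)[OF u, of s] by auto
    then show "norm (vector_field g a (u s) - vector_field g b (u s)) \<le> (L + 1) * norm (a - b)"
      using add_increasing2[OF norm_ge_zero[of "a - b"] lip[of k a b]] by (simp add: distrib_right)
  next
    fix y :: "real \<Rightarrow> real^'n" assume "continuous_on {0..T} y"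
    from field_absolutely_integrable[where g = g, OF u cont this]
    show "(\<lambda>s. vector_field g (y s) (u s)) integrable_on {0..T}"
      by (rule set_lebesgue_integral_eq_integral)
  qed (use assms in \<open>auto simp: step_on_def\<close>)
  then show ?thesis
    unfolding is_trajectory_def using field_absolutely_integrable[where g = g, OF u cont] by blast
qed

section \<open>Fields with bounded second derivative\<close>

text \<open>A bound on the second derivative enters only through the Lipschitz continuity of the derivative
  and the quadratic Taylor remainder; the latter is the mean value inequality for
  \<open>z \<mapsto> g z - g' a z\<close> on the segment from \<open>a\<close> to \<open>b\<close>.\<close>

lemma C2_boundedE:
  assumes "C2_bounded g K"
  obtains g' :: "'a::real_normed_vector \<Rightarrow> 'a \<Rightarrow>\<^sub>L 'b::real_normed_vector"
  where "0 \<le> K"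
    and "\<And>a. (g has_derivative blinfun_apply (g' a)) (at a)"
    and "\<And>a b. norm (g' a - g' b) \<le> K * norm (a - b)"
    and "\<And>a b. norm (g b - g a - blinfun_apply (g' a) (b - a)) \<le> K * (norm (b - a))\<^sup>2"
proof -
  obtain g' :: "'a \<Rightarrow> 'a \<Rightarrow>\<^sub>L 'b" and g'' where
      g': "\<And>a. (g has_derivative blinfun_apply (g' a)) (at a)"
      and g'': "\<And>a. (g' has_derivative blinfun_apply (g'' a)) (at a)"
      and K: "\<And>a. norm (g'' a) \<le> K"
    using assms unfolding C2_bounded_def by blast
  have "0 \<le> K" using norm_ge_zero K order_trans by blast
  have lip: "norm (g' a - g' b) \<le> K * norm (a - b)" for a b
    by (rule differentiable_bound[of UNIV g' "\<lambda>a. blinfun_apply (g'' a)"])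
      (use g'' K in \<open>auto simp: norm_blinfun.rep_eq[symmetric]\<close>)
  have "norm (g b - g a - blinfun_apply (g' a) (b - a)) \<le> K * (norm (b - a))\<^sup>2" for a b
  proof -
    let ?h = "\<lambda>z. g z - blinfun_apply (g' a) z"
    have "norm (?h b - ?h a) \<le> (K * norm (b - a)) * norm (b - a)"
    proof (rule differentiable_bound[of "closed_segment a b" ?h "\<lambda>z. blinfun_apply (g' z - g' a)"])
      fix z assume z: "z \<in> closed_segment a b"
      show "(?h has_derivative blinfun_apply (g' z - g' a)) (at z within closed_segment a b)"
        by (auto intro!: derivative_eq_intros has_derivative_at_withinI[OF g']
            simp: blinfun.diff_left)
      have "norm (g' z - g' a) \<le> K * norm (b - a)"
        using lip[of z a] segment_bound(1)[OF z] \<open>0 \<le> K\<close>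
        by (meson mult_left_mono order_trans)
      then show "onorm (blinfun_apply (g' z - g' a)) \<le> K * norm (b - a)"
        by (simp add: norm_blinfun.rep_eq)
    qed auto
    then show ?thesis by (simp add: blinfun.diff_right power2_eq_square algebra_simps)
  qed
  with that \<open>0 \<le> K\<close> g' lip show ?thesis by blast
qed

lemma C2_bounded_continuous:
  assumes "C2_bounded g K" shows "continuous_on UNIV g"
proof -
  obtain g' where "\<And>a. (g has_derivative blinfun_apply (g' a)) (at a)"
    using assms by (rule C2_boundedE) blast
  then show ?thesis
    by (intro continuous_at_imp_continuous_on ballI) (blast intro: has_derivative_continuous)
qed

lemma C2_bounded_lipschitz_on_ball:
  assumes "C2_bounded g K"
  shows "\<exists>L\<ge>0. \<forall>a\<in>cball 0 R. \<forall>b\<in>cball 0 R. norm (g a - g b) \<le> L * norm (a - b)"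
proof -
  obtain g' where "0 \<le> K" and g': "\<And>a. (g has_derivative blinfun_apply (g' a)) (at a)"
    and lip: "\<And>a b. norm (g' a - g' b) \<le> K * norm (a - b)"
    using assms by (rule C2_boundedE) blast
  let ?L = "norm (g' 0) + K * \<bar>R\<bar>"
  have "norm (g a - g b) \<le> ?L * norm (a - b)" if ab: "a \<in> cball 0 R" "b \<in> cball 0 R" for a b
  proof (rule differentiable_bound[of "cball 0 R" g "\<lambda>z. blinfun_apply (g' z)"])
    fix z :: 'a assume z: "z \<in> cball 0 R"
    show "(g has_derivative blinfun_apply (g' z)) (at z within cball 0 R)"
      using g' by (rule has_derivative_at_withinI)
    have "norm (g' z) \<le> norm (g' 0) + norm (g' z - g' 0)"
      by (metis norm_triangle_sub)
    also have "norm (g' z - g' 0) \<le> K * norm z" using lip[of z 0] by simp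
    also have "K * norm z \<le> K * \<bar>R\<bar>" using z \<open>0 \<le> K\<close> by (intro mult_left_mono) auto
    finally show "onorm (blinfun_apply (g' z)) \<le> ?L" by (simp add: norm_blinfun.rep_eq)
  qed (use ab in auto)
  moreover have "0 \<le> ?L" using \<open>0 \<le> K\<close> by simp
  ultimately show ?thesis by blast
qed

text \<open>Composing with the nearest-point projection onto a ball, which is nonexpansive, makes fields that
  are Lipschitz on the ball globally Lipschitz and keeps their values inside.\<close>

lemma truncated_fields:
  fixes f :: "'m::finite \<Rightarrow> real^'n \<Rightarrow> real^'n"
  assumes f: "\<And>k. C2_bounded (f k) K" and "0 \<le> R"
  obtains g L where "0 \<le> L" "\<And>k a b. norm (g k a - g k b) \<le> L * norm (a - b)"
    "\<And>k a. norm a \<le> R \<Longrightarrow> g k a = f k a"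
proof -
  have "\<forall>k. \<exists>L\<ge>0. \<forall>a\<in>cball 0 R. \<forall>b\<in>cball 0 R. norm (f k a - f k b) \<le> L * norm (a - b)"
    using C2_bounded_lipschitz_on_ball[OF f] by blast
  then obtain L where L: "\<And>k. 0 \<le> L k"
    "\<And>k a b. a \<in> cball 0 R \<Longrightarrow> b \<in> cball 0 R \<Longrightarrow> norm (f k a - f k b) \<le> L k * norm (a - b)"
    by metis
  define p where "p = closest_point (cball (0::real^'n) R)"
  have p: "p a \<in> cball 0 R" "norm (p a - p b) \<le> norm (a - b)" for a b
    using \<open>0 \<le> R\<close> closest_point_in_set[of "cball 0 R" a]
      closest_point_lipschitz[of "cball 0 R" a b] by (auto simp: p_def dist_norm)
  have "norm (f k (p a) - f k (p b)) \<le> sum L UNIV * norm (a - b)" for k a b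
  proof -
    have "norm (f k (p a) - f k (p b)) \<le> L k * norm (p a - p b)" by (intro L p)
    also have "\<dots> \<le> sum L UNIV * norm (a - b)"
      using L(1) p by (intro mult_mono member_le_sum sum_nonneg) auto
    finally show ?thesis .
  qed
  moreover have "f k (p a) = f k a" if "norm a \<le> R" for k a
    using that by (simp add: p_def closest_point_self)
  ultimately show ?thesis using that[of "sum L UNIV" "\<lambda>k a. f k (p a)"] L(1)
    by (simp add: sum_nonneg)
qed

lemma lipschitz_family_bound:
  fixes g :: "'m::finite \<Rightarrow> 'a::real_normed_vector \<Rightarrow> 'b::real_normed_vector"
  assumes lip: "\<And>k a b. norm (g k a - g k b) \<le> L * norm (a - b)"
    and "0 \<le> L" "norm a \<le> R"
  shows "norm (g k a) \<le> (\<Sum>k\<in>UNIV. norm (g k 0)) + L * R"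
proof -
  have "norm (g k a) \<le> norm (g k 0) + norm (g k a - g k 0)" by (metis norm_triangle_sub)
  also have "\<dots> \<le> (\<Sum>k\<in>UNIV. norm (g k 0)) + L * R"
    using lip[of k a 0] mult_left_mono[OF assms(3,2)] by (intro add_mono member_le_sum) auto
  finally show ?thesis .
qed

text \<open>Both trajectories are bounded, so they solve the same truncated, globally Lipschitz system.\<close>

lemma trajectory_unique:
  fixes f :: "'m::finite \<Rightarrow> real^'n \<Rightarrow> real^'n"
  assumes f: "\<And>k. C2_bounded (f k) K" and u: "step_on T P modes u"
    and x: "is_trajectory T x0 f u x" and y: "is_trajectory T x0 f u y"
    and t: "t \<in> {0..T}"
  shows "y t = x t"
proof -
  obtain R1 where R1: "0 \<le> R1" "\<And>t. t \<in> {0..T} \<Longrightarrow> norm (x t) \<le> R1"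
    using bounded_on_compact_interval[OF trajectory_continuous[OF x]] by blast
  obtain R2 where R2: "0 \<le> R2" "\<And>t. t \<in> {0..T} \<Longrightarrow> norm (y t) \<le> R2"
    using bounded_on_compact_interval[OF trajectory_continuous[OF y]] by blast
  obtain g L where g: "0 \<le> L" "\<And>k a b. norm (g k a - g k b) \<le> L * norm (a - b)"
    "\<And>k a. norm a \<le> R1 + R2 \<Longrightarrow> g k a = f k a"
    by (rule truncated_fields[of f K "R1 + R2", OF f add_nonneg_nonneg[OF R1(1) R2(1)]]) blast
  have "is_trajectory T x0 g u x" "is_trajectory T x0 g u y"
    using x y R1 R2 is_trajectory_cong[of T f x g] is_trajectory_cong[of T f y g]
    by (auto simp: g(3) add_increasing add_increasing2)
  moreover have "switched_time T u u = 0" by (simp add: switched_time_def)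
  moreover have "norm (g k (x s)) \<le> (\<Sum>k\<in>UNIV. norm (g k 0)) + L * R1" if "s \<in> {0..T}" for k s
    by (rule lipschitz_family_bound[where g = g, OF g(2,1) R1(2)[OF that]])
  ultimately have "norm (y t - x t) \<le> 2 * ((\<Sum>k\<in>UNIV. norm (g k 0)) + L * R1) * 0 * exp (L * T)"
    using trajectory_perturbation[where g = g, OF u u g(1,2) _ _ _ t] by metis
  then show ?thesis by simp
qed

text \<open>The trajectory of the truncated system is within distance \<open>1\<close> of \<open>x\<close> when the switched time is small,
  hence never leaves the ball in which truncation is invisible. The bounds are uniform in the
  control, which the quadratic estimate of the cost depends on.\<close>

lemma nearby_trajectory:
  fixes f :: "'m::finite \<Rightarrow> real^'n \<Rightarrow> real^'n"
  assumes "0 \<le> T" and f: "\<And>k. C2_bounded (f k) K" and u: "step_on T P modes u"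
    and x: "is_trajectory T x0 f u x"
  obtains m0 C R where "m0 > 0" "0 \<le> C" "0 \<le> R"
    "\<And>t. t \<in> {0..T} \<Longrightarrow> norm (x t) \<le> R"
    "\<And>Q v. step_on T Q modes v \<Longrightarrow> switched_time T u v < m0 \<Longrightarrow>
      \<exists>y. is_trajectory T x0 f v y \<and>
        (\<forall>t\<in>{0..T}. norm (y t - x t) \<le> C * switched_time T u v \<and> norm (y t) \<le> R)"
proof -
  obtain R where R: "0 \<le> R" "\<And>t. t \<in> {0..T} \<Longrightarrow> norm (x t) \<le> R"
    using bounded_on_compact_interval[OF trajectory_continuous[OF x]] by blast
  obtain g L where g: "0 \<le> L" "\<And>k a b. norm (g k a - g k b) \<le> L * norm (a - b)"
    "\<And>k a. norm a \<le> R + 1 \<Longrightarrow> g k a = f k a"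
    by (rule truncated_fields[of f K "R + 1", OF f add_nonneg_nonneg[OF R(1) zero_le_one]]) blast
  define M where "M = (\<Sum>k\<in>UNIV. norm (g k 0)) + L * R"
  have M: "norm (g k (x s)) \<le> M" if "s \<in> {0..T}" for k s
    unfolding M_def by (rule lipschitz_family_bound[where g = g, OF g(2,1) R(2)[OF that]])
  have "0 \<le> M" unfolding M_def using g(1) R(1) by (intro add_nonneg_nonneg sum_nonneg) auto
  define C where "C = 2 * M * exp (L * T)"
  have C: "0 \<le> C" using \<open>0 \<le> M\<close> by (simp add: C_def)
  have xg: "is_trajectory T x0 g u x"
    using x is_trajectory_cong[of T f x g] R(2) g(3) by (force simp: add_increasing2)
  have "\<exists>y. is_trajectory T x0 f v y \<and>
      (\<forall>t\<in>{0..T}. norm (y t - x t) \<le> C * switched_time T u v \<and> norm (y t) \<le> R + 1)"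
    if v: "step_on T Q modes v" and m: "switched_time T u v < 1 / (C + 1)" for Q v
  proof -
    obtain y where y: "is_trajectory T x0 g v y"
      using trajectory_exists_lipschitz[where g = g, OF \<open>0 \<le> T\<close> v g(1,2)] by blast
    have *: "norm (y t - x t) \<le> C * switched_time T u v" if "t \<in> {0..T}" for t
      using trajectory_perturbation[where g = g, OF u v g(1,2) xg y M that] by (simp add: C_def mult_ac)
    \<comment> \<open>\<open>C + 1\<close> instead of \<open>C\<close> because \<open>C\<close> may be zero\<close>
    have "C * switched_time T u v \<le> (C + 1) * switched_time T u v"
      using switched_time_nonneg[of T u v] by (simp add: algebra_simps)
    also have "\<dots> \<le> 1" using m C by (simp add: field_simps)
    finally have "norm (y t) \<le> R + 1" if "t \<in> {0..T}" for t
      using *[OF that] R(2)[OF that] norm_triangle_sub[of "y t" "x t"] by linarith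
    moreover from this have "is_trajectory T x0 f v y"
      using y is_trajectory_cong[of T f y g] g(3) by force
    ultimately show ?thesis using * by blast
  qed
  moreover have "0 < 1 / (C + 1)" using C by simp
  moreover have "norm (x t) \<le> R + 1" if "t \<in> {0..T}" for t using R(2)[OF that] by simp
  ultimately show ?thesis using that[of "1 / (C + 1)" C "R + 1"] C R(1) by force
qed

section \<open>The costate and the first-order change of the cost\<close>

lemma adjoint_eq_sum_Basis:
  fixes A :: "'a::euclidean_space \<Rightarrow> 'b::euclidean_space"
  assumes "linear A"
  shows "adjoint A r = (\<Sum>b\<in>Basis. (r \<bullet> A b) *\<^sub>R b)"
proof -
  have "adjoint A r \<bullet> b = r \<bullet> A b" for b
    using adjoint_works[OF assms, of b r] by (simp add: inner_commute)
  then show ?thesis using euclidean_representation[of "adjoint A r"] by simp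
qed

lemma costate_continuous:
  assumes "is_costate T f l x u \<rho>"
  shows "continuous_on {0..T} \<rho>"
proof -
  obtain g where "g integrable_on {0..T}" "\<And>t. t \<in> {0..T} \<Longrightarrow> \<rho> t = integral {t..T} g"
    using assms unfolding is_costate_def Let_def by (blast intro: set_lebesgue_integral_eq_integral)
  then show ?thesis
    using indefinite_integral_continuous_1'[of g 0 T] by (subst continuous_on_cong) auto
qed

text \<open>The adjoint equation in differential form: off the switching times the costate is differentiable,
  and the derivative is described by its inner products, which is the form that pairs with the
  difference of two trajectories.\<close>

lemma costate_derivative:
  fixes f :: "'m::finite \<Rightarrow> real^'n \<Rightarrow> real^'n"
  assumes u: "step_on T P modes u" and x: "continuous_on {0..T} x"
    and f': "\<And>k a. (f k has_derivative blinfun_apply (f' k a)) (at a)"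
    and f'_cont: "\<And>k. continuous_on UNIV (f' k)"
    and l': "\<And>a. (l has_derivative blinfun_apply (l' a)) (at a)"
    and l'_cont: "continuous_on UNIV l'"
    and \<rho>: "is_costate T f l x u \<rho>"
  shows "\<exists>g. \<forall>t\<in>{0..T} - P. \<forall>k. u t = axis k 1 \<longrightarrow>
      (\<rho> has_vector_derivative - g t) (at t) \<and>
      (\<forall>e. g t \<bullet> e = \<rho> t \<bullet> blinfun_apply (f' k (x t)) e + blinfun_apply (l' (x t)) e)"
proof -
  define H where "H s c = adjoint (frechet_derivative (\<lambda>y. vector_field f y c) (at (x s))) (\<rho> s)
      + adjoint (frechet_derivative l (at (x s))) 1" for s c
  define g where "g s = H s (u s)" for s
  have g_int: "g integrable_on {0..T}" and \<rho>_eq: "\<And>t. t \<in> {0..T} \<Longrightarrow> \<rho> t = integral {t..T} g"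
    using \<rho> unfolding is_costate_def Let_def g_def[abs_def] H_def
    by (auto intro: set_lebesgue_integral_eq_integral)
  note \<rho>_cont = costate_continuous[OF \<rho>]
  have fd: "frechet_derivative (f k) (at a) = blinfun_apply (f' k a)"
    "frechet_derivative l (at a) = blinfun_apply (l' a)" for k a
    using frechet_derivative_at[OF f'] frechet_derivative_at[OF l'] by auto
  have lin: "linear (blinfun_apply A)" for A :: "'x::real_normed_vector \<Rightarrow>\<^sub>L 'y::real_normed_vector"
    by (rule bounded_linear.linear) (rule blinfun.bounded_linear_right)
  have H_axis: "H s (axis k 1) = (\<Sum>b\<in>Basis. (\<rho> s \<bullet> blinfun_apply (f' k (x s)) b) *\<^sub>R b)
      + (\<Sum>b\<in>Basis. (1 \<bullet> blinfun_apply (l' (x s)) b) *\<^sub>R b)" for s k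
    by (simp only: H_def vector_field_axis fd adjoint_eq_sum_Basis[OF lin] eta_contract_eq)
  have H_cont: "continuous_on {0..T} (\<lambda>s. H s c)" if c: "c \<in> modes" for c
  proof -
    obtain k where "c = axis k 1" using c by blast
    then show ?thesis
      unfolding H_axis using \<rho>_cont x
        continuous_on_compose2[OF f'_cont x] continuous_on_compose2[OF l'_cont x]
      by (auto simp: H_axis intro!: continuous_intros)
  qed
  have "(\<rho> has_vector_derivative - g t) (at t)"
    and "g t \<bullet> e = \<rho> t \<bullet> blinfun_apply (f' k (x t)) e + blinfun_apply (l' (x t)) e"
    if t: "t \<in> {0..T} - P" and k: "u t = axis k 1" for t k e
  proof -
    have tT: "t \<in> {0<..<T}" by (rule step_on_interior[OF u t])
    have "isCont g t"
      unfolding g_def[abs_def] by (rule isCont_along_step[OF u t]) (rule H_cont)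
    then have "((\<lambda>s. integral {0..T} g - integral {0..s} g) has_vector_derivative 0 - g t) (at t)"
      by (intro has_vector_derivative_diff has_vector_derivative_const
          integral_has_vector_derivative_at_continuity[OF g_int tT])
    moreover have "\<rho> s = integral {0..T} g - integral {0..s} g" if "s \<in> {0<..<T}" for s
      using \<rho>_eq[of s] Henstock_Kurzweil_Integration.integral_combine[of 0 s T g] g_int that by (simp add: algebra_simps)
    ultimately show "(\<rho> has_vector_derivative - g t) (at t)"
      using has_vector_derivative_transform_within_open[OF _ open_greaterThanLessThan tT]
      by (metis (no_types, lifting) diff_0)
    have "g t \<bullet> e = e \<bullet> adjoint (blinfun_apply (f' k (x t))) (\<rho> t)
        + e \<bullet> adjoint (blinfun_apply (l' (x t))) 1"
      by (simp add: g_def k H_def fd inner_commute inner_add_left inner_add_right)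
    also have "\<dots> = \<rho> t \<bullet> blinfun_apply (f' k (x t)) e + blinfun_apply (l' (x t)) e"
      by (simp add: adjoint_works[OF lin] inner_commute)
    finally show "g t \<bullet> e = \<rho> t \<bullet> blinfun_apply (f' k (x t)) e + blinfun_apply (l' (x t)) e" .
  qed
  then show ?thesis by blast
qed

text \<open>With \<open>e = y - x\<close>, the product of \<open>\<rho>\<close> and \<open>e\<close> vanishes at both ends because \<open>\<rho> T = 0\<close> and \<open>e 0 = 0\<close>.
  Adding its derivative \<open>p\<close> to the integrand therefore does not change the difference of the costs,
  but it cancels all terms linear in \<open>e\<close>: what remains is quadratic in \<open>e\<close> while the controls agree, and
  otherwise the mode insertion gradient, at most \<open>- c\<close>, plus terms of order \<open>E\<close>.\<close>

lemma cost_difference_le: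
  fixes f :: "'m::finite \<Rightarrow> real^'n \<Rightarrow> real^'n"
  assumes T: "0 \<le> T" and f: "\<And>k. C2_bounded (f k) K" and l: "C2_bounded l K'"
    and u: "step_on T P modes u" and v: "step_on T Q modes v"
    and x: "is_trajectory T x0 f u x" and y: "is_trajectory T x0 f v y"
    and \<rho>: "is_costate T f l x u \<rho>"
    and B: "\<And>t. t \<in> {0..T} \<Longrightarrow> norm (\<rho> t) \<le> B"
    and "0 \<le> L" and L: "\<And>k t. t \<in> {0..T} \<Longrightarrow> norm (f k (y t) - f k (x t)) \<le> L * norm (y t - x t)"
    and E: "\<And>t. t \<in> {0..T} \<Longrightarrow> norm (y t - x t) \<le> E"
    and c: "\<And>t. t \<in> {0..T} - (P \<union> Q) \<Longrightarrow> u t \<noteq> v t \<Longrightarrow>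
      \<rho> t \<bullet> (vector_field f (x t) (v t) - vector_field f (x t) (u t)) \<le> - c"
  shows "cost T l (y, v) - cost T l (x, u)
    \<le> (B * K + K') * E\<^sup>2 * T + (2 * B * L * E - c) * switched_time T u v"
proof -
  have "\<forall>k. \<exists>g'. (\<forall>a. (f k has_derivative blinfun_apply (g' a)) (at a)) \<and>
      (\<forall>a b. norm (g' a - g' b) \<le> K * norm (a - b)) \<and>
      (\<forall>a b. norm (f k b - f k a - blinfun_apply (g' a) (b - a)) \<le> K * (norm (b - a))\<^sup>2)"
    by (rule allI, rule C2_boundedE[OF f]) blast
  then obtain f' where f': "\<And>k a. (f k has_derivative blinfun_apply (f' k a)) (at a)"
    and f'_lip: "\<And>k a b. norm (f' k a - f' k b) \<le> K * norm (a - b)"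
    and f_taylor: "\<And>k a b. norm (f k b - f k a - blinfun_apply (f' k a) (b - a)) \<le> K * (norm (b - a))\<^sup>2"
    by metis
  obtain l' where "0 \<le> K'" and l': "\<And>a. (l has_derivative blinfun_apply (l' a)) (at a)"
    and l'_lip: "\<And>a b. norm (l' a - l' b) \<le> K' * norm (a - b)"
    and l_taylor: "\<And>a b. norm (l b - l a - blinfun_apply (l' a) (b - a)) \<le> K' * (norm (b - a))\<^sup>2"
    by (rule C2_boundedE[OF l]) blast
  have "0 \<le> K" using f C2_boundedE by metis
  have f'_cont: "continuous_on UNIV (f' k)" for k
    by (rule lipschitz_on_continuous_on[of K]) (use f'_lip \<open>0 \<le> K\<close> in \<open>auto simp: lipschitz_on_def dist_norm\<close>)
  have l'_cont: "continuous_on UNIV l'"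
    by (rule lipschitz_on_continuous_on[of K']) (use l'_lip \<open>0 \<le> K'\<close> in \<open>auto simp: lipschitz_on_def dist_norm\<close>)
  note f_cont = C2_bounded_continuous[OF f]
  note xc = trajectory_continuous[OF x] and yc = trajectory_continuous[OF y]
  note \<rho>_cont = costate_continuous[OF \<rho>]
  obtain g where g: "\<And>t k. t \<in> {0..T} - P \<Longrightarrow> u t = axis k 1 \<Longrightarrow> (\<rho> has_vector_derivative - g t) (at t)"
    "\<And>t k e. t \<in> {0..T} - P \<Longrightarrow> u t = axis k 1 \<Longrightarrow>
      g t \<bullet> e = \<rho> t \<bullet> blinfun_apply (f' k (x t)) e + blinfun_apply (l' (x t)) e"
    using costate_derivative[OF u xc f' f'_cont l' l'_cont \<rho>] by blast
  have fin: "finite (P \<union> Q)" using u v by (simp add: step_on_def)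
  define e where "e t = y t - x t" for t
  \<comment> \<open>the derivative of \<open>\<rho> \<bullet> e\<close>\<close>
  define p where "p t = \<rho> t \<bullet> (vector_field f (y t) (v t) - vector_field f (x t) (u t)) + (- g t) \<bullet> e t" for t
  have "(p has_integral \<rho> T \<bullet> e T - \<rho> 0 \<bullet> e 0) {0..T}"
  proof (rule fundamental_theorem_of_calculus_interior_strong[OF fin T])
    fix t assume "t \<in> {0<..<T} - (P \<union> Q)"
    then have t: "t \<in> {0..T} - P" "t \<in> {0..T} - Q" by auto
    obtain k where k: "u t = axis k 1" using step_on_value(1)[OF u t(1)] by blast
    have "(e has_vector_derivative vector_field f (y t) (v t) - vector_field f (x t) (u t)) (at t)"
      unfolding e_def[abs_def]
      by (intro has_vector_derivative_diff trajectory_has_derivative[OF u f_cont x t(1)]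
          trajectory_has_derivative[OF v f_cont y t(2)])
    from bounded_bilinear.has_vector_derivative[OF bounded_bilinear_inner g(1)[OF t(1) k] this]
    show "((\<lambda>t. \<rho> t \<bullet> e t) has_vector_derivative p t) (at t)"
      by (simp add: p_def)
  next
    show "continuous_on {0..T} (\<lambda>t. \<rho> t \<bullet> e t)"
      unfolding e_def by (intro continuous_intros \<rho>_cont xc yc)
  qed
  moreover have "\<rho> T = 0" "e 0 = 0"
    using \<rho> x y T by (auto simp: is_costate_def Let_def is_trajectory_def e_def)
  ultimately have p: "(p has_integral 0) {0..T}" by simp
  have lx: "(\<lambda>t. l (x t)) integrable_on {0..T}" and ly: "(\<lambda>t. l (y t)) integrable_on {0..T}"
    using continuous_on_compose2[OF C2_bounded_continuous[OF l] xc]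
      continuous_on_compose2[OF C2_bounded_continuous[OF l] yc]
    by (auto intro: integrable_continuous_real)
  define w where "w t = (of_bool (u t \<noteq> v t) :: real)" for t
  have w: "w integrable_on {0..T}"
    unfolding w_def[abs_def] by (rule switched_integrable[OF u v])
  have E0: "0 \<le> E" and B0: "0 \<le> B"
    using E[of 0] B[of 0] T norm_ge_zero order_trans atLeastAtMost_iff order_refl by metis+
  have "cost T l (y, v) - cost T l (x, u) = integral {0..T} (\<lambda>t. l (y t) - l (x t) + p t)"
    using lx ly p integral_unique[OF p]
    by (simp add: cost_def integral_add integral_diff integrable_diff has_integral_integrable)
  also have "\<dots> \<le> integral {0..T} (\<lambda>t. (B * K + K') * E\<^sup>2 + (2 * B * L * E - c) * w t)"
  proof (rule integral_le_off_finite[OF _ _ fin])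
    show "(\<lambda>t. l (y t) - l (x t) + p t) integrable_on {0..T}"
      using lx ly p by (intro integrable_add integrable_diff) auto
    show "(\<lambda>t. (B * K + K') * E\<^sup>2 + (2 * B * L * E - c) * w t) integrable_on {0..T}"
      by (intro integrable_add integrable_on_mult_right w integrable_const_ivl)
    fix t assume "t \<in> {0..T} - (P \<union> Q)"
    then have t: "t \<in> {0..T} - P" "t \<in> {0..T} - Q" "t \<in> {0..T}" by auto
    obtain k where k: "u t = axis k 1" using step_on_value(1)[OF u t(1)] by blast
    obtain a where a: "v t = axis a 1" using step_on_value(1)[OF v t(2)] by blast
    have e2: "(norm (e t))\<^sup>2 \<le> E\<^sup>2" using E[OF t(3)] by (simp add: e_def power_mono)
    have inner_le: "\<rho> t \<bullet> z \<le> B * r" if "norm z \<le> r" for z r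
    proof -
      have "\<rho> t \<bullet> z \<le> norm (\<rho> t) * norm z" by (rule norm_cauchy_schwarz)
      also have "\<dots> \<le> B * r" using B[OF t(3)] that B0 by (intro mult_mono) auto
      finally show ?thesis .
    qed
    have l1: "l (y t) - l (x t) - blinfun_apply (l' (x t)) (e t) \<le> K' * E\<^sup>2"
      using l_taylor[of "y t" "x t"] mult_left_mono[OF e2 \<open>0 \<le> K'\<close>] by (simp add: e_def)
    define rem where "rem = f k (y t) - f k (x t) - blinfun_apply (f' k (x t)) (e t)"
    have "norm rem \<le> K * E\<^sup>2"
      using f_taylor[of k "y t" "x t"] mult_left_mono[OF e2 \<open>0 \<le> K\<close>] by (simp add: rem_def e_def)
    then have r1: "\<rho> t \<bullet> rem \<le> B * (K * E\<^sup>2)" by (rule inner_le)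
    have L': "norm (f j (y t) - f j (x t)) \<le> L * E" for j
      using L[OF t(3), of j] mult_left_mono[OF E[OF t(3)] \<open>0 \<le> L\<close>] by simp
    have p_eq: "p t = \<rho> t \<bullet> (f a (y t) - f k (x t)) - \<rho> t \<bullet> blinfun_apply (f' k (x t)) (e t)
        - blinfun_apply (l' (x t)) (e t)"
      using g(2)[OF t(1) k, of "e t"] by (simp add: p_def k a inner_diff_right)
    show "l (y t) - l (x t) + p t \<le> (B * K + K') * E\<^sup>2 + (2 * B * L * E - c) * w t"
    proof (cases "u t = v t")
      case True
      then have "f a = f k" using k a by (simp add: axis_eq_axis)
      then have "l (y t) - l (x t) + p t = l (y t) - l (x t) - blinfun_apply (l' (x t)) (e t) + \<rho> t \<bullet> rem"
        by (simp add: p_eq rem_def inner_diff_right)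
      then show ?thesis using l1 r1 True by (simp add: w_def algebra_simps)
    next
      case False
      have "\<rho> t \<bullet> (f a (x t) - f k (x t)) \<le> - c"
        using c[of t] t False by (simp add: k a)
      moreover have "\<rho> t \<bullet> (f a (y t) - f a (x t)) \<le> B * (L * E)"
        by (rule inner_le) (rule L')
      moreover have "\<rho> t \<bullet> (f k (x t) - f k (y t)) \<le> B * (L * E)"
        using L'[of k] by (intro inner_le) (simp add: norm_minus_commute)
      moreover have "l (y t) - l (x t) + p t = l (y t) - l (x t) - blinfun_apply (l' (x t)) (e t)
          + \<rho> t \<bullet> (f a (x t) - f k (x t)) + \<rho> t \<bullet> (f a (y t) - f a (x t))
          + \<rho> t \<bullet> (f k (x t) - f k (y t)) + \<rho> t \<bullet> rem"
        by (simp add: p_eq rem_def inner_diff_right)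
      ultimately show ?thesis using l1 r1 False by (simp add: w_def algebra_simps)
    qed
  qed
  also have "\<dots> = (B * K + K') * E\<^sup>2 * T + (2 * B * L * E - c) * switched_time T u v"
    using T w integral_add[OF integrable_const_ivl[of _ 0 T] integrable_on_mult_right[OF w]]
    by (simp add: switched_time_def w_def[abs_def, symmetric] mult.commute[of T])
  finally show ?thesis .
qed

text \<open>The distance of the trajectories is proportional to the switched time, so both error terms of the
  previous estimate are multiples of its square, uniformly in the control \<open>v\<close>.\<close>

lemma cost_perturbation:
  fixes f :: "'m::finite \<Rightarrow> real^'n \<Rightarrow> real^'n"
  assumes T: "0 \<le> T" and f: "\<And>k. C2_bounded (f k) K" and l: "C2_bounded l K'"
    and u: "step_on T P modes u"
    and x: "is_trajectory T x0 f u x"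
    and \<rho>: "is_costate T f l x u \<rho>"
  obtains m0 C where "m0 > 0" "C \<ge> 0"
    "\<And>Q v c. step_on T Q modes v \<Longrightarrow> switched_time T u v < m0 \<Longrightarrow>
      (\<And>t. t \<in> {0..T} - (P \<union> Q) \<Longrightarrow> u t \<noteq> v t \<Longrightarrow>
        \<rho> t \<bullet> (vector_field f (x t) (v t) - vector_field f (x t) (u t)) \<le> - c) \<Longrightarrow>
      \<exists>y. is_trajectory T x0 f v y \<and> cost T l (y, v) - cost T l (x, u)
        \<le> - c * switched_time T u v + C * (switched_time T u v)\<^sup>2"
proof -
  obtain m0 D R where "m0 > 0" "0 \<le> D" "0 \<le> R"
    and xR: "\<And>t. t \<in> {0..T} \<Longrightarrow> norm (x t) \<le> R"
    and near: "\<And>Q v. step_on T Q modes v \<Longrightarrow> switched_time T u v < m0 \<Longrightarrow>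
      \<exists>y. is_trajectory T x0 f v y \<and>
        (\<forall>t\<in>{0..T}. norm (y t - x t) \<le> D * switched_time T u v \<and> norm (y t) \<le> R)"
    by (rule nearby_trajectory[where f = f, OF T f u x]) blast
  obtain B where "0 \<le> B" and B: "\<And>t. t \<in> {0..T} \<Longrightarrow> norm (\<rho> t) \<le> B"
    using bounded_on_compact_interval[OF costate_continuous[OF \<rho>]] by blast
  obtain g L where g: "0 \<le> L" "\<And>k a b. norm (g k a - g k b) \<le> L * norm (a - b)"
    "\<And>k a. norm a \<le> R \<Longrightarrow> g k a = f k a"
    by (rule truncated_fields[of f K R, OF f \<open>0 \<le> R\<close>]) blast
  have "0 \<le> K" "0 \<le> K'" using f l C2_boundedE by metis+
  define C where "C = (B * K + K') * D\<^sup>2 * T + 2 * B * L * D"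
  show ?thesis
  proof (rule that)
    show "m0 > 0" by fact
    show "C \<ge> 0"
      unfolding C_def using \<open>0 \<le> K\<close> \<open>0 \<le> K'\<close> \<open>0 \<le> B\<close> \<open>0 \<le> D\<close> T g(1) by simp
    fix Q v c
    assume v: "step_on T Q modes v" and m: "switched_time T u v < m0"
      and c: "\<And>t. t \<in> {0..T} - (P \<union> Q) \<Longrightarrow> u t \<noteq> v t \<Longrightarrow>
        \<rho> t \<bullet> (vector_field f (x t) (v t) - vector_field f (x t) (u t)) \<le> - c"
    define m where "m = switched_time T u v"
    obtain y where y: "is_trajectory T x0 f v y"
      "\<And>t. t \<in> {0..T} \<Longrightarrow> norm (y t - x t) \<le> D * m" "\<And>t. t \<in> {0..T} \<Longrightarrow> norm (y t) \<le> R"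
      using near[OF v m] by (auto simp: m_def)
    have "norm (f k (y t) - f k (x t)) \<le> L * norm (y t - x t)" if "t \<in> {0..T}" for k t
      using g(2)[of k "y t" "x t"] g(3) xR y(3) that by simp
    from cost_difference_le[where f = f, OF T f l u v x y(1) \<rho> B g(1) this y(2) c]
    have "cost T l (y, v) - cost T l (x, u)
        \<le> (B * K + K') * (D * m)\<^sup>2 * T + (2 * B * L * (D * m) - c) * m"
      by (simp add: m_def)
    also have "\<dots> = - c * m + C * m\<^sup>2"
      by (simp add: C_def power2_eq_square algebra_simps)
    finally show "\<exists>y. is_trajectory T x0 f v y \<and> cost T l (y, v) - cost T l (x, u)
        \<le> - c * switched_time T u v + C * (switched_time T u v)\<^sup>2"
      using y(1) by (auto simp: m_def)
  qed
qed

section \<open>Switching controls and the projection\<close>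

lemma unit_vector_is_axis:
  fixes c :: "real^'m"
  assumes "\<And>i. c $ i \<in> {0, 1}" "(\<Sum>i\<in>UNIV. c $ i) = 1"
  shows "c \<in> modes"
proof -
  have "(\<Sum>i\<in>UNIV. c $ i) = (\<Sum>i\<in>UNIV. if i \<in> {i. c $ i = 1} then 1 else 0)"
    using assms(1) by (intro sum.cong) auto
  also have "\<dots> = real (card {i. c $ i = 1})"
    by (simp add: sum.If_cases)
  finally have "card {i. c $ i = 1} = 1" using assms(2) by simp
  then obtain k where k: "{i. c $ i = 1} = {k}" by (auto simp: card_1_singleton_iff)
  then have "c $ i = (if i = k then 1 else 0)" for i
    using assms(1)[of i] by (cases "i = k") auto
  then have "c = axis k 1" by (simp add: vec_eq_iff axis_def)
  then show ?thesis by blast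
qed

text \<open>An open interval of constancy has positive measure, so the almost everywhere condition holds at
  one of its times, hence at all of them.\<close>

lemma switching_control_step_on:
  fixes u :: "real \<Rightarrow> real^'m"
  assumes "switching_control T u"
  shows "\<exists>P. step_on T P modes u"
proof -
  obtain P0 where P0: "finite P0"
    "\<And>a b. {a<..<b} \<subseteq> {0..T} - P0 \<Longrightarrow> u constant_on {a<..<b}"
    using assms unfolding switching_control_def piecewise_constant_def by blast
  let ?good = "\<lambda>t. t \<in> {0..T} \<longrightarrow> (\<forall>i. u t $ i \<in> {0, 1}) \<and> (\<Sum>i\<in>UNIV. u t $ i) = 1"
  have ae: "AE t in lebesgue. ?good t"
    using assms unfolding switching_control_def by blast
  have "step_on T (insert 0 (insert T P0)) modes u"
    unfolding step_on_def
  proof (intro conjI ballI)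
    fix t assume t: "t \<in> {0..T} - insert 0 (insert T P0)"
    have "open ({0<..<T} - P0)" using P0(1) by (intro open_Diff finite_imp_closed) auto
    moreover have "t \<in> {0<..<T} - P0" using t by auto
    ultimately obtain e where e: "e > 0" "ball t e \<subseteq> {0<..<T} - P0"
      unfolding open_contains_ball by blast
    define I where "I = {t - e<..<t + e}"
    have I: "I \<subseteq> {0<..<T} - P0" using e(2) by (simp add: I_def ball_eq_greaterThanLessThan)
    then have "I \<subseteq> {0..T} - P0" by auto
    then have "u constant_on I" unfolding I_def by (rule P0(2))
    then obtain c where c: "\<And>s. s \<in> I \<Longrightarrow> u s = c" unfolding constant_on_def by blast
    have "\<exists>s\<in>I. ?good s"
    proof (rule ccontr)
      assume "\<not> (\<exists>s\<in>I. ?good s)"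
      then have sub: "I \<subseteq> {t. \<not> ?good t}" by blast
      obtain N where N: "{t \<in> space lebesgue. \<not> ?good t} \<subseteq> N" "emeasure lebesgue N = 0" "N \<in> sets lebesgue"
        by (rule AE_E[OF ae])
      then have "negligible N" by (simp add: negligible_iff_null_sets null_setsI)
      then have "negligible {t. \<not> ?good t}"
        by (rule negligible_subset) (use N(1) in simp)
      then have "negligible I" using sub negligible_subset by blast
      then show False
        using open_not_negligible[of I] e(1) by (auto simp: I_def)
    qed
    then have "c \<in> modes" using c I by (force intro: unit_vector_is_axis)
    moreover have "\<forall>\<^sub>F s in nhds t. s \<in> I"
      using e(1) by (intro eventually_nhds_in_open) (auto simp: I_def)
    then have "\<forall>\<^sub>F s in nhds t. u s = c" by eventually_elim (rule c)
    ultimately show "\<exists>c\<in>modes. \<forall>\<^sub>F s in nhds t. u s = c" by blast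
  qed (use P0(1) in auto)
  then show ?thesis by blast
qed

text \<open>A jump of the one-sided limits can only occur at an exceptional time, so there are finitely many
  switching times and their gaps have a positive minimum.\<close>

lemma step_on_Omega:
  fixes v :: "real \<Rightarrow> real^'m"
  assumes v: "step_on T P modes v"
  shows "v \<in> Omega T"
proof -
  have fin: "finite P" using v by (simp add: step_on_def)
  have pc: "piecewise_constant T v"
    unfolding piecewise_constant_def
  proof (intro exI[of _ P] conjI allI impI)
    fix a b assume ab: "{a<..<b} \<subseteq> {0..T} - P"
    show "v constant_on {a<..<b}"
    proof (rule locally_constant_imp_constant)
      fix s assume "s \<in> {a<..<b}"
      then have "\<forall>\<^sub>F r in nhds s. v r = v s" by (intro step_on_value(2)[OF v] subsetD[OF ab])
      then obtain S where S: "open S" "s \<in> S" "\<forall>r\<in>S. v r = v s"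
        by (auto simp: eventually_nhds)
      then show "\<exists>S. openin (top_of_set {a<..<b}) S \<and> s \<in> S \<and> (\<forall>r\<in>S. v r = v s)"
        using openin_open_Int[OF S(1), of "{a<..<b}"] S(2,3) \<open>s \<in> {a<..<b}\<close>
        by (intro exI[of _ "{a<..<b} \<inter> S"]) blast
    qed simp
  qed (rule fin)
  have "(\<forall>i. v t $ i \<in> {0, 1}) \<and> (\<Sum>i\<in>UNIV. v t $ i) = 1" if "t \<in> {0..T} - P" for t
    using step_on_value(1)[OF v that] by (auto simp: axis_def)
  moreover have "AE t in lebesgue. t \<notin> P"
    using negligible_finite[OF fin] by (intro AE_not_in) (simp add: negligible_iff_null_sets)
  ultimately have ae: "AE t in lebesgue. t \<in> {0..T} \<longrightarrow> (\<forall>i. v t $ i \<in> {0, 1}) \<and> (\<Sum>i\<in>UNIV. v t $ i) = 1"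
    by (auto elim!: eventually_mono)
  have "switching_times T v \<subseteq> P"
  proof
    fix t assume t: "t \<in> switching_times T v"
    show "t \<in> P"
    proof (rule ccontr)
      assume "t \<notin> P"
      then have tP: "t \<in> {0..T} - P" using t by (auto simp: switching_times_def)
      have "isCont v t" using isCont_along_step[OF v tP, of "\<lambda>_ c. c"] by simp
      then have lim: "(v \<longlongrightarrow> v t) (at_left t)" "(v \<longlongrightarrow> v t) (at_right t)"
        by (auto simp: isCont_def filterlim_at_split)
      from tendsto_Lim[OF _ lim(1)] tendsto_Lim[OF _ lim(2)] t show False
        by (simp add: switching_times_def)
    qed
  qed
  then have finS: "finite (switching_times T v)" using fin finite_subset by blast
  \<comment> \<open>the element \<open>1\<close> makes the set of gaps nonempty when there is at most one switching time\<close>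
  define G where "G = insert 1 ((\<lambda>(s, t). t - s) ` (switching_times T v \<times> switching_times T v) \<inter> {0<..})"
  have finG: "finite G"
    unfolding G_def by (intro finite.insertI finite_Int disjI1 finite_imageI finite_cartesian_product finS)
  have "0 < Min G" using finG by (subst Min_gr_iff) (auto simp: G_def)
  moreover have "Min G / 2 < t - s"
    if "s \<in> switching_times T v" "t \<in> switching_times T v" "s < t" for s t
  proof -
    have "t - s \<in> G" unfolding G_def using that by (intro insertI2 IntI image_eqI[of _ _ "(s, t)"]) simp_all
    then have "Min G \<le> t - s" by (rule Min_le[OF finG])
    then show ?thesis using \<open>0 < Min G\<close> by linarith
  qed
  ultimately have "non_chattering T v"
    unfolding non_chattering_def by (intro exI[of _ "Min G / 2"]) auto
  with pc ae show ?thesis by (simp add: Omega_def switching_control_def)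
qed

lemma feasible_set_step_on:
  assumes v: "step_on T Q modes v" and y: "is_trajectory T x0 f v y"
  shows "(y, v) \<in> feasible_set T x0 f"
proof -
  have "v absolutely_integrable_on {0..T}"
    using absolutely_integrable_along_step[OF v, of "\<lambda>_ c. c"] by simp
  moreover have "y absolutely_integrable_on {0..T}"
    by (rule absolutely_integrable_continuous_real[OF trajectory_continuous[OF y]])
  ultimately show ?thesis using step_on_Omega[OF v] y by (simp add: feasible_set_def)
qed

text \<open>By Rolle's theorem two noncritical points of the same level are separated by a critical point, so
  a noncritical point of the level set is determined by the critical points to its left.\<close>

lemma finite_level_set:
  assumes fin: "finite (critical_points T g)"
  shows "finite {t\<in>{0..T}. g t = c}"
proof -
  let ?C = "critical_points T g" and ?A = "{t\<in>{0..T}. g t = c}"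
  have between: "\<exists>z\<in>?C. s < z \<and> z < t" if s: "s \<in> ?A - ?C" and t: "t \<in> ?A - ?C" and "s < t" for s t
  proof (rule ccontr)
    assume no: "\<not> (\<exists>z\<in>?C. s < z \<and> z < t)"
    have diff: "g differentiable (at z within {0..T})" if "z \<in> {s..t}" for z
    proof -
      have "z \<notin> ?C" using no s t that by (cases "z = s \<or> z = t") auto
      then show ?thesis using s t that by (auto simp: critical_points_def)
    qed
    have "\<exists>z. s < z \<and> z < t \<and> DERIV g z :> 0"
    proof (rule Rolle[OF \<open>s < t\<close>])
      show "g s = g t" using s t by simp
      show "continuous_on {s..t} g"
        unfolding continuous_on_eq_continuous_within
      proof
        fix z assume z: "z \<in> {s..t}"
        show "continuous (at z within {s..t}) g"
          by (rule continuous_within_subset[OF differentiable_imp_continuous_within[OF diff[OF z]]])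
            (use s t in auto)
      qed
      fix z assume z: "s < z" "z < t"
      then have "at z within {0..T} = at z" using s t by (intro at_within_interior) auto
      then show "g differentiable (at z)" using diff[of z] z by simp
    qed
    then obtain z where z: "s < z" "z < t" "DERIV g z :> 0" by blast
    then have "z \<in> ?C" using s t
      by (auto simp: critical_points_def intro: has_field_derivative_at_within)
    with no z show False by blast
  qed
  have "inj_on (\<lambda>t. ?C \<inter> {..<t}) (?A - ?C)"
  proof (rule linorder_inj_onI')
    fix s t assume "s \<in> ?A - ?C" "t \<in> ?A - ?C" "s < t"
    then obtain z where "z \<in> ?C" "s < z" "z < t" using between by blast
    then have "z \<in> ?C \<inter> {..<t}" "z \<notin> ?C \<inter> {..<s}" by auto
    then show "?C \<inter> {..<s} \<noteq> ?C \<inter> {..<t}" by blast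
  qed
  moreover have "finite ((\<lambda>t. ?C \<inter> {..<t}) ` (?A - ?C))"
    by (rule finite_subset[of _ "Pow ?C"]) (blast, rule iffD2[OF finite_Pow_iff fin])
  ultimately have "finite (?A - ?C)" by (rule finite_imageD[rotated])
  with fin show ?thesis by (simp only: finite_Diff2)
qed

lemma Q_proj_eq_axis:
  assumes "\<And>j. j \<noteq> k \<Longrightarrow> w $ j < w $ k"
  shows "Q_proj w = axis k 1"
proof -
  have "Q_proj w $ i = axis k 1 $ i" for i
  proof (cases "i = k")
    case True
    then show ?thesis using assms by (auto simp: Q_proj_def step1_def axis_def less_imp_le intro!: prod.neutral)
  next
    case False
    then have "\<exists>j\<in>UNIV - {i}. step1 (w $ i - w $ j) = 0"
      using assms[of i] by (intro bexI[of _ k]) (auto simp: step1_def)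
    then show ?thesis using False by (simp add: Q_proj_def axis_def)
  qed
  then show ?thesis by (simp add: vec_eq_iff)
qed

lemma Q_proj_eq_axisD:
  assumes "Q_proj w = axis k 1"
  shows "w $ j \<le> w $ k"
proof (cases "j = k")
  case False
  have "(\<Prod>j\<in>UNIV - {k}. step1 (w $ k - w $ j)) \<noteq> 0"
    using arg_cong[OF assms, of "\<lambda>z. z $ k"] by (simp add: Q_proj_def axis_def)
  then have "step1 (w $ k - w $ j) \<noteq> 0" using False by auto
  then show ?thesis by (auto simp: step1_def split: if_splits)
qed simp

text \<open>Components \<open>i\<close> and \<open>j\<close> of \<open>u - \<gamma> d\<close> tie only where \<open>d i - d j\<close> equals \<open>(u i - u j) / \<gamma>\<close>, a number
  with three possible values; these level sets are finite. Elsewhere the maximal component is unique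
  and stays so nearby.\<close>

lemma projected_control_step_on:
  fixes u d :: "real \<Rightarrow> real^'m::finite"
  assumes u: "step_on T P modes u" and "\<gamma> > 0"
    and d: "\<And>t. t \<in> {0..T} - P \<Longrightarrow> isCont d t"
    and crit: "\<And>i j. i \<noteq> j \<Longrightarrow> finite (critical_points T (\<lambda>t. d t $ i - d t $ j))"
  shows "\<exists>Q. step_on T Q modes (\<lambda>t. Q_proj (u t - \<gamma> *\<^sub>R d t))"
proof -
  define \<mu> where "\<mu> t = u t - \<gamma> *\<^sub>R d t" for t
  define tie where "tie i j = (\<Union>c\<in>{-1, 0, 1}. {t\<in>{0..T}. d t $ i - d t $ j = c / \<gamma>})" for i j
  define B where "B = (\<Union>i. \<Union>j\<in>UNIV - {i}. tie i j)"
  have "finite (tie i j)" if "i \<noteq> j" for i j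
    unfolding tie_def by (intro finite_UN_I finite_level_set crit[OF that]) simp
  then have "finite B" unfolding B_def by (intro finite_UN_I) auto
  have "step_on T (P \<union> B) modes (\<lambda>t. Q_proj (\<mu> t))"
    unfolding step_on_def
  proof (intro conjI ballI)
    fix t assume t: "t \<in> {0..T} - (P \<union> B)"
    then have tP: "t \<in> {0..T} - P" by auto
    have no_tie: "\<mu> t $ i \<noteq> \<mu> t $ j" if "i \<noteq> j" for i j
    proof
      assume "\<mu> t $ i = \<mu> t $ j"
      then have "d t $ i - d t $ j = (u t $ i - u t $ j) / \<gamma>"
        using \<open>\<gamma> > 0\<close> by (simp add: \<mu>_def field_simps)
      moreover have "u t $ i - u t $ j \<in> {-1, 0, 1}"
        using step_on_value(1)[OF u tP] by (elim rangeE) (simp add: axis_def)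
      ultimately have "t \<in> tie i j"
        unfolding tie_def using t by (intro UN_I[of "u t $ i - u t $ j"]) simp_all
      then have "t \<in> B"
        unfolding B_def using that by (intro UN_I[of i] UN_I[of j]) simp_all
      with t show False by blast
    qed
    have "Max (range (($) (\<mu> t))) \<in> range (($) (\<mu> t))" by (rule Max_in) simp_all
    then obtain k where k: "Max (range (($) (\<mu> t))) = \<mu> t $ k" by blast
    have le: "\<mu> t $ j \<le> \<mu> t $ k" for j unfolding k[symmetric] by (rule Max_ge) simp_all
    have "isCont u t" using isCont_along_step[OF u tP, of "\<lambda>_ c. c"] by simp
    then have cont: "isCont (\<lambda>s. \<mu> s $ j) t" for j
      unfolding \<mu>_def using d[OF tP] by (intro continuous_intros)
    have "\<forall>\<^sub>F s in nhds t. \<mu> s $ j < \<mu> s $ k" if "j \<noteq> k" for j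
    proof -
      have "\<mu> t $ j < \<mu> t $ k" using le[of j] no_tie[OF that] by simp
      moreover have "((\<lambda>s. \<mu> s $ k - \<mu> s $ j) \<longlongrightarrow> \<mu> t $ k - \<mu> t $ j) (nhds t)"
        using continuous_diff[OF cont[of k] cont[of j]]
        unfolding continuous_at tendsto_at_iff_tendsto_nhds[of "\<lambda>s. \<mu> s $ k - \<mu> s $ j" t] .
      ultimately have "\<forall>\<^sub>F s in nhds t. 0 < \<mu> s $ k - \<mu> s $ j"
        by (intro order_tendstoD(1)) auto
      then show ?thesis by eventually_elim simp
    qed
    then have "\<forall>\<^sub>F s in nhds t. \<forall>j\<in>UNIV - {k}. \<mu> s $ j < \<mu> s $ k"
      by (intro eventually_ball_finite) auto
    then have "\<forall>\<^sub>F s in nhds t. Q_proj (\<mu> s) = axis k 1"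
      by eventually_elim (auto intro: Q_proj_eq_axis)
    then show "\<exists>c\<in>modes. \<forall>\<^sub>F s in nhds t. Q_proj (\<mu> s) = c" by blast
  qed (use u \<open>finite B\<close> in \<open>auto simp: step_on_def\<close>)
  then show ?thesis unfolding \<mu>_def by blast
qed

text \<open>The projection selects some trajectory; by uniqueness it agrees on \<open>[0, T]\<close> with any given one.\<close>

lemma P_proj_trajectory:
  fixes f :: "'m::finite \<Rightarrow> real^'n \<Rightarrow> real^'n"
  assumes f: "\<And>k. C2_bounded (f k) K"
    and v: "step_on T Q modes (\<lambda>t. Q_proj (\<mu> t))"
    and y: "is_trajectory T x0 f (\<lambda>t. Q_proj (\<mu> t)) y"
  obtains z where "P_proj T x0 f (\<alpha>, \<mu>) = (z, \<lambda>t. Q_proj (\<mu> t))"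
    "is_trajectory T x0 f (\<lambda>t. Q_proj (\<mu> t)) z" "\<And>t. t \<in> {0..T} \<Longrightarrow> z t = y t"
proof
  let ?v = "\<lambda>t. Q_proj (\<mu> t)"
  define z where "z = (SOME x. is_trajectory T x0 f ?v x)"
  show "P_proj T x0 f (\<alpha>, \<mu>) = (z, ?v)" by (simp add: P_proj_def Let_def z_def)
  show z: "is_trajectory T x0 f ?v z" unfolding z_def by (rule someI[where P = "is_trajectory T x0 f ?v", OF y])
  show "z t = y t" if "t \<in> {0..T}" for t by (rule trajectory_unique[where f = f, OF f v y z that])
qed

section \<open>Descent along the mode insertion gradient\<close>

lemma mode_insertion_gradient_continuous:
  fixes f :: "'m::finite \<Rightarrow> real^'n \<Rightarrow> real^'n"
  assumes f: "\<And>k. continuous_on UNIV (f k)"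
    and x: "continuous_on {0..T} x" and \<rho>: "continuous_on {0..T} \<rho>"
  shows "continuous_on {0..T} (\<lambda>s. mode_insertion_gradient f x (\<lambda>_. axis k 1) \<rho> s)"
  unfolding mode_insertion_gradient_def vector_field_axis
  by (intro continuous_on_vec_lambda continuous_intros \<rho> continuous_on_compose2[OF f x]) auto

text \<open>At a fixed time off a finite set all components of \<open>d\<close> exceed \<open>\<theta> = - 1 / \<gamma>0\<close> strictly, so the
  projection returns \<open>u\<close> for all \<open>\<gamma>\<close> close enough to \<open>\<gamma>0\<close>. The indicator of disagreement thus tends to
  \<open>0\<close> pointwise off a finite set, and dominated convergence applies along every sequence.\<close>

lemma switched_time_tendsto_0:
  fixes u d :: "real \<Rightarrow> real^'m::finite"
  assumes u: "step_on T P modes u"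
    and v: "\<And>\<gamma>. \<gamma> > \<gamma>0 \<Longrightarrow> \<exists>Q. step_on T Q modes (\<lambda>t. Q_proj (u t - \<gamma> *\<^sub>R d t))"
    and active: "\<And>t k. t \<in> {0..T} - P \<Longrightarrow> u t = axis k 1 \<Longrightarrow> d t $ k = 0"
    and lower: "\<And>t a. t \<in> {0..T} \<Longrightarrow> \<theta> \<le> d t $ a"
    and crit: "\<And>i j. i \<noteq> j \<Longrightarrow> finite (critical_points T (\<lambda>t. d t $ i - d t $ j))"
    and "\<theta> < 0" and \<gamma>0: "\<gamma>0 = - 1 / \<theta>"
  shows "((\<lambda>\<gamma>. switched_time T u (\<lambda>t. Q_proj (u t - \<gamma> *\<^sub>R d t))) \<longlongrightarrow> 0) (at_right \<gamma>0)"
  unfolding tendsto_at_iff_sequentially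
proof (intro allI impI)
  fix X :: "nat \<Rightarrow> real"
  assume X: "\<forall>i. X i \<in> {\<gamma>0<..} - {\<gamma>0}" and lim: "X \<longlonglongrightarrow> \<gamma>0"
  have "\<gamma>0 > 0" using \<open>\<theta> < 0\<close> by (simp add: \<gamma>0 divide_neg_neg)
  define touch where "touch a k = {t\<in>{0..T}. d t $ a - d t $ k = \<theta>}" for a k
  define B where "B = P \<union> (\<Union>a. \<Union>k\<in>UNIV - {a}. touch a k)"
  have "finite P" using u by (simp add: step_on_def)
  moreover have "finite (touch a k)" if "a \<noteq> k" for a k
    unfolding touch_def by (rule finite_level_set[OF crit[OF that]])
  ultimately have "finite B" unfolding B_def by (intro finite_UnI finite_UN_I) auto
  then have neg: "negligible B" by (rule negligible_finite)
  define w where "w i t = (of_bool (u t \<noteq> Q_proj (u t - X i *\<^sub>R d t)) :: real)" for i t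
  define w' where "w' i t = (if t \<in> B then 0 else w i t)" for i t
  have w: "w i integrable_on {0..T}" for i
    unfolding w_def[abs_def] using v[of "X i"] X switched_integrable[OF u] by fastforce
  have eq: "integral {0..T} (w i) = integral {0..T} (w' i)" for i
    by (rule integral_spike[OF neg]) (simp add: w'_def)
  have "(\<lambda>i. integral {0..T} (w' i)) \<longlonglongrightarrow> integral {0..T} (\<lambda>_. 0)"
  proof (rule dominated_convergence(2)[where h = "\<lambda>_. 1"])
    show "w' i integrable_on {0..T}" for i
      by (rule integrable_spike[OF w neg]) (simp add: w'_def)
    show "(\<lambda>_. 1 :: real) integrable_on {0..T}" by (rule integrable_const_ivl)
    show "norm (w' i t) \<le> 1" for i t by (simp add: w'_def w_def)
    fix t assume t: "t \<in> {0..T}"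
    show "(\<lambda>i. w' i t) \<longlonglongrightarrow> 0"
    proof (cases "t \<in> B")
      case False
      then have tP: "t \<in> {0..T} - P" using t by (simp add: B_def)
      obtain k where k: "u t = axis k 1" using step_on_value(1)[OF u tP] by blast
      have dk: "d t $ k = 0" by (rule active[OF tP k])
      have "\<forall>\<^sub>F i in sequentially. - (X i * d t $ a) < 1" if "a \<noteq> k" for a
      proof -
        have "t \<in> B" if "t \<in> touch a k"
          unfolding B_def using that \<open>a \<noteq> k\<close> by (intro UnI2 UN_I[of a] UN_I[of k]) simp_all
        with False have "t \<notin> touch a k" by metis
        then have "d t $ a - d t $ k \<noteq> \<theta>" using t by (simp add: touch_def)
        then have "\<theta> < d t $ a" using lower[OF t, of a] dk by simp
        then have "- (\<gamma>0 * d t $ a) < 1"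
          unfolding \<gamma>0 using \<open>\<theta> < 0\<close> by (simp add: neg_divide_less_eq)
        moreover have "(\<lambda>i. - (X i * d t $ a)) \<longlonglongrightarrow> - (\<gamma>0 * d t $ a)"
          by (intro tendsto_intros lim)
        ultimately show ?thesis by (rule order_tendstoD(2)[rotated])
      qed
      then have "\<forall>\<^sub>F i in sequentially. \<forall>a\<in>UNIV - {k}. - (X i * d t $ a) < 1"
        by (intro eventually_ball_finite) auto
      then have "\<forall>\<^sub>F i in sequentially. w' i t = 0"
      proof eventually_elim
        case (elim i)
        have "Q_proj (u t - X i *\<^sub>R d t) = axis k 1"
        proof (rule Q_proj_eq_axis)
          fix a assume "a \<noteq> k"
          then show "(u t - X i *\<^sub>R d t) $ a < (u t - X i *\<^sub>R d t) $ k"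
            using elim by (simp add: k dk axis_def)
        qed
        then show ?case by (simp add: w'_def w_def k)
      qed
      then show ?thesis by (rule tendsto_eventually)
    qed (simp add: w'_def)
  qed
  then show "((\<lambda>\<gamma>. switched_time T u (\<lambda>t. Q_proj (u t - \<gamma> *\<^sub>R d t))) \<circ> X) \<longlonglongrightarrow> 0"
    by (simp add: o_def switched_time_def eq[unfolded w_def[abs_def]])
qed

theorem corollary3:
  fixes T K2 K2' \<theta> \<gamma>0 :: real
    and x0 :: "real^'n"
    and f :: "'m::finite \<Rightarrow> real^'n \<Rightarrow> real^'n"
    and l :: "real^'n \<Rightarrow> real"
    and x \<rho> :: "real \<Rightarrow> real^'n"
    and u d :: "real \<Rightarrow> real^'m"
    and J :: "real \<Rightarrow> real"
  assumes "T > 0"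
    and "\<And>i. C2_bounded (f i) K2"
    and "C2_bounded l K2'"
    and "(x, u) \<in> feasible_set T x0 f"
    and "right_continuous T u"
    and "is_costate T f l x u \<rho>"
    and "d = mode_insertion_gradient f x u \<rho>"
    and "piecewise_continuous T d"
    and "\<And>i j. i \<noteq> j \<Longrightarrow> finite (critical_points T (\<lambda>t. d t $ i - d t $ j))"
    and "\<theta> = optimality_function T d"
    and "\<theta> < 0"
    and "\<gamma>0 = - 1 / \<theta>"
    and "\<And>i. real_analytic (f i)"
    and "real_analytic l"
    and "\<And>\<gamma>. J \<gamma> = cost T l (P_proj T x0 f (x, \<lambda>t. u t - \<gamma> *\<^sub>R d t))"
  shows "\<exists>\<delta>>0. \<forall>\<gamma>\<in>{\<gamma>0<..<\<gamma>0 + \<delta>}.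
           (\<lambda>t. u t - \<gamma> *\<^sub>R d t) \<in> R_set T \<and>
           P_proj T x0 f (x, \<lambda>t. u t - \<gamma> *\<^sub>R d t) \<in> feasible_set T x0 f \<and>
           J \<gamma> < J 0"
proof -
  note f = assms(2) and l = assms(3) and d_def = assms(7) and crit = assms(9)
  have "0 \<le> T" using \<open>T > 0\<close> by simp
  have x: "is_trajectory T x0 f u x" and u_int: "u absolutely_integrable_on {0..T}"
    and "switching_control T u"
    using assms(4) by (auto simp: feasible_set_def Omega_def)
  then obtain P where u: "step_on T P modes u" using switching_control_step_on by blast
  have f_cont: "continuous_on UNIV (f k)" for k by (rule C2_bounded_continuous[OF f])
  have xc: "continuous_on {0..T} x" by (rule trajectory_continuous[OF x])
  have \<rho>c: "continuous_on {0..T} \<rho>" by (rule costate_continuous[OF assms(6)])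
  have \<rho>T: "\<rho> T = 0" using assms(6) \<open>0 \<le> T\<close> by (auto simp: is_costate_def Let_def)

  \<comment> \<open>the mode insertion gradient with the active mode frozen, so that it is continuous in time\<close>
  define D where "D s c = mode_insertion_gradient f x (\<lambda>_. c) \<rho> s" for s c
  have d_eq: "d s = D s (u s)" for s by (simp add: d_def D_def mode_insertion_gradient_def)
  have D_cont: "continuous_on {0..T} (\<lambda>s. D s c)" if "c \<in> modes" for c
    using that mode_insertion_gradient_continuous[where f = f, OF f_cont xc \<rho>c] by (auto simp: D_def)
  have d_isCont: "isCont d t" if "t \<in> {0..T} - P" for t
    using isCont_along_step[OF u that D_cont] by (simp add: d_eq[abs_def])
  have d_int: "d absolutely_integrable_on {0..T}"
    using absolutely_integrable_along_step[OF u D_cont] by (simp add: d_eq[abs_def])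
  have active: "d t $ k = 0" if "u t = axis k 1" for t k
    using that by (simp add: d_def mode_insertion_gradient_def)
  have d_diff: "d t $ a = \<rho> t \<bullet> (vector_field f (x t) (axis a 1) - vector_field f (x t) (u t))" for t a
    by (simp add: d_def mode_insertion_gradient_def)
  have dT: "d T = 0" by (simp add: d_def mode_insertion_gradient_def \<rho>T vec_eq_iff)

  \<comment> \<open>the infimum is a lower bound because \<open>d\<close> is bounded on all of \<open>[0, T]\<close>; the time \<open>T\<close>, at which \<open>u\<close> may
    be no unit vector, is harmless since \<open>\<rho> T = 0\<close>\<close>
  have \<theta>_eq: "\<theta> = (INF z\<in>UNIV \<times> {0..T}. d (snd z) $ fst z)"
    using assms(10) by (simp add: optimality_function_def case_prod_beta)
  obtain M where M: "\<And>s c. s \<in> {0..T} \<Longrightarrow> c \<in> modes \<Longrightarrow> norm (D s c) \<le> M"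
    using bounded_along_step[OF u, of D] D_cont by blast
  have "norm (d t) \<le> \<bar>M\<bar>" if "t \<in> {0..T}" for t
  proof (cases "t = T")
    case False
    then have "u t \<in> modes" using right_continuous_step_on(1)[OF u assms(5)] that by auto
    then have "norm (d t) \<le> M" unfolding d_eq by (rule M[OF that])
    then show ?thesis by simp
  qed (simp add: dT)
  then have d_le: "\<bar>d t $ a\<bar> \<le> \<bar>M\<bar>" if "t \<in> {0..T}" for t a
    using that component_le_norm_cart[of "d t" a] by (meson order_trans)
  have bdd: "bdd_below ((\<lambda>z. d (snd z) $ fst z) ` (UNIV \<times> {0..T}))"
  proof (rule bdd_belowI2[where m = "- \<bar>M\<bar>"])
    fix z :: "'m \<times> real" assume "z \<in> UNIV \<times> {0..T}"
    then show "- \<bar>M\<bar> \<le> d (snd z) $ fst z"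
      using d_le[of "snd z" "fst z"] by (simp add: mem_Times_iff)
  qed
  have lower: "\<theta> \<le> d t $ a" if "t \<in> {0..T}" for t a
    using cINF_lower[OF bdd, of "(a, t)"] that by (simp add: \<theta>_eq)

  have "\<gamma>0 > 0" using \<open>\<theta> < 0\<close> assms(12) by (simp add: divide_neg_neg)
  define v where "v \<gamma> t = Q_proj (u t - \<gamma> *\<^sub>R d t)" for \<gamma> t
  define m where "m \<gamma> = switched_time T u (v \<gamma>)" for \<gamma>
  have v_step: "\<exists>Q. step_on T Q modes (v \<gamma>)" if "\<gamma> > 0" for \<gamma>
    unfolding v_def[abs_def] by (rule projected_control_step_on[OF u that d_isCont crit])

  have m_lim: "(m \<longlongrightarrow> 0) (at_right \<gamma>0)"
    unfolding m_def v_def[abs_def]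
    by (rule switched_time_tendsto_0[OF u _ active lower crit assms(11,12)])
      (use v_step \<open>\<gamma>0 > 0\<close> in \<open>auto simp: v_def[abs_def]\<close>)

  have m_pos: "m \<gamma> > 0" if "\<gamma> > \<gamma>0" for \<gamma>
  proof -
    have "\<gamma> > 0" using that \<open>\<gamma>0 > 0\<close> by simp
    have "\<theta> < - 1 / \<gamma>" using that \<open>\<theta> < 0\<close> \<open>\<gamma> > 0\<close> assms(12) by (simp add: field_simps)
    have "\<exists>z\<in>UNIV \<times> {0..T}. d (snd z) $ fst z < - 1 / \<gamma>"
    proof (rule ccontr)
      assume "\<not> ?thesis"
      then have "- 1 / \<gamma> \<le> \<theta>"
        unfolding \<theta>_eq using \<open>0 \<le> T\<close> by (intro cINF_greatest) (auto simp: not_less)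
      with \<open>\<theta> < - 1 / \<gamma>\<close> show False by simp
    qed
    then obtain a t where at: "t \<in> {0..T}" "d t $ a < - 1 / \<gamma>" by auto
    have "- 1 / \<gamma> < 0" using \<open>\<gamma> > 0\<close> by simp
    then have "t \<noteq> T" using at(2) dT by auto
    then have t: "t \<in> {0..<T}" using at(1) by auto
    have ut: "u t \<in> modes" "\<forall>\<^sub>F s in at_right t. u s = u t"
      using right_continuous_step_on[OF u assms(5) t] by auto
    have "continuous (at_right t) (\<lambda>s. D s (u t) $ a)"
    proof -
      have "continuous (at t within {t..T}) (\<lambda>s. D s (u t))"
        by (rule continuous_within_subset[of _ "{0..T}"])
          (use D_cont[OF ut(1)] at(1) in \<open>auto simp: continuous_on_eq_continuous_within\<close>)
      then have "continuous (at_right t) (\<lambda>s. D s (u t))"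
        using t by (simp add: continuous_within at_within_Icc_at_right)
      then show ?thesis by (intro continuous_intros)
    qed
    then have "((\<lambda>s. D s (u t) $ a) \<longlongrightarrow> d t $ a) (at_right t)"
      by (simp add: continuous_within d_eq)
    from order_tendstoD(2)[OF this at(2)] ut(2)
    have "\<forall>\<^sub>F s in at_right t. d s $ a < - 1 / \<gamma>"
      by eventually_elim (simp add: d_eq)
    then obtain b where b: "b > t" "\<And>s. t < s \<Longrightarrow> s < b \<Longrightarrow> d s $ a < - 1 / \<gamma>"
      by (auto simp: eventually_at_right_field)
    obtain Q where Q: "step_on T Q modes (v \<gamma>)" using v_step[OF \<open>\<gamma> > 0\<close>] by blast
    show ?thesis
      unfolding m_def
    proof (rule switched_time_positive[OF u Q, of t "min b T"])
      fix s assume s: "s \<in> {t<..<min b T} - P"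
      then have "s \<in> {0..T} - P" using t by auto
      then obtain k where k: "u s = axis k 1" using step_on_value(1)[OF u] by blast
      have ds: "d s $ a < - 1 / \<gamma>" using b(2) s by auto
      then have "1 < - (\<gamma> * d s $ a)" using \<open>\<gamma> > 0\<close> by (simp add: field_simps)
      moreover have "a \<noteq> k" using ds active[OF k] \<open>- 1 / \<gamma> < 0\<close> by auto
      ultimately show "u s \<noteq> v \<gamma> s"
        using Q_proj_eq_axisD[of "u s - \<gamma> *\<^sub>R d s" k a] active[OF k]
        by (auto simp: v_def k axis_def)
    qed (use t b in auto)
  qed

  \<comment> \<open>for \<open>\<gamma> = 0\<close> the projection changes \<open>u\<close> at finitely many times only\<close>
  have J0: "J 0 = cost T l (x, u)"
  proof -
    have "Q_proj (u t - 0 *\<^sub>R d t) = u t" if t: "t \<in> {0..T} - P" for t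
    proof -
      obtain k where "u t = axis k 1" using step_on_value(1)[OF u t] by blast
      moreover have "Q_proj (axis k 1) = (axis k 1 :: real^'m)"
        by (rule Q_proj_eq_axis) (simp add: axis_def)
      ultimately show ?thesis by simp
    qed
    note eq = this
    have "step_on T P modes (\<lambda>t. Q_proj (u t - 0 *\<^sub>R d t))"
      by (rule step_on_cong[OF u eq])
    moreover have "is_trajectory T x0 f (\<lambda>t. Q_proj (u t - 0 *\<^sub>R d t)) x"
      by (rule is_trajectory_cong_control[OF x _ eq]) (use u in \<open>auto simp: step_on_def\<close>)
    ultimately obtain z where z:
      "P_proj T x0 f (x, \<lambda>t. u t - 0 *\<^sub>R d t) = (z, \<lambda>t. Q_proj (u t - 0 *\<^sub>R d t))"
      "\<And>t. t \<in> {0..T} \<Longrightarrow> z t = x t"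
      by (rule P_proj_trajectory[where f = f, OF f]) blast
    show ?thesis unfolding assms(15) z(1) by (rule cost_cong[OF z(2)])
  qed

  obtain m0 C where "m0 > 0" "C \<ge> 0" and perturb:
    "\<And>Q v c. step_on T Q modes v \<Longrightarrow> switched_time T u v < m0 \<Longrightarrow>
      (\<And>t. t \<in> {0..T} - (P \<union> Q) \<Longrightarrow> u t \<noteq> v t \<Longrightarrow>
        \<rho> t \<bullet> (vector_field f (x t) (v t) - vector_field f (x t) (u t)) \<le> - c) \<Longrightarrow>
      \<exists>y. is_trajectory T x0 f v y \<and> cost T l (y, v) - cost T l (x, u)
        \<le> - c * switched_time T u v + C * (switched_time T u v)\<^sup>2"
    by (rule cost_perturbation[where f = f, OF \<open>0 \<le> T\<close> f l u x assms(6)]) blast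
  \<comment> \<open>a lower bound of \<open>1 / \<gamma>\<close> for all \<open>\<gamma> < \<gamma>0 + 1\<close>\<close>
  define c where "c = 1 / (\<gamma>0 + 1)"
  have "c > 0" using \<open>\<gamma>0 > 0\<close> by (simp add: c_def)
  have "\<forall>\<^sub>F \<gamma> in at_right \<gamma>0. m \<gamma> < min m0 (c / (C + 1))"
    using \<open>m0 > 0\<close> \<open>c > 0\<close> \<open>C \<ge> 0\<close> by (intro order_tendstoD(2)[OF m_lim]) auto
  then obtain b where b: "b > \<gamma>0" "\<And>\<gamma>. \<gamma>0 < \<gamma> \<Longrightarrow> \<gamma> < b \<Longrightarrow> m \<gamma> < min m0 (c / (C + 1))"
    by (auto simp: eventually_at_right_field)
  define \<delta> where "\<delta> = min 1 (b - \<gamma>0)"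
  have "\<delta> > 0" using b(1) by (simp add: \<delta>_def)
  moreover have "(\<lambda>t. u t - \<gamma> *\<^sub>R d t) \<in> R_set T \<and>
      P_proj T x0 f (x, \<lambda>t. u t - \<gamma> *\<^sub>R d t) \<in> feasible_set T x0 f \<and> J \<gamma> < J 0"
    if \<gamma>: "\<gamma> \<in> {\<gamma>0<..<\<gamma>0 + \<delta>}" for \<gamma>
  proof -
    have "\<gamma> > 0" "\<gamma> > \<gamma>0" "\<gamma> < \<gamma>0 + 1" using \<gamma> \<open>\<gamma>0 > 0\<close> by (auto simp: \<delta>_def)
    have m: "0 < m \<gamma>" "m \<gamma> < m0" "m \<gamma> < c / (C + 1)"
      using m_pos[OF \<open>\<gamma> > \<gamma>0\<close>] b(2)[of \<gamma>] \<gamma> by (auto simp: \<delta>_def)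
    obtain Q where Q: "step_on T Q modes (v \<gamma>)" using v_step[OF \<open>\<gamma> > 0\<close>] by blast
    have "\<rho> t \<bullet> (vector_field f (x t) (v \<gamma> t) - vector_field f (x t) (u t)) \<le> - c"
      if t: "t \<in> {0..T} - (P \<union> Q)" and ne: "u t \<noteq> v \<gamma> t" for t
    proof -
      obtain k where k: "u t = axis k 1" using step_on_value(1)[OF u, of t] t by blast
      obtain a where a: "v \<gamma> t = axis a 1" using step_on_value(1)[OF Q, of t] t by blast
      have "a \<noteq> k" using ne k a by auto
      then have "1 \<le> - (\<gamma> * d t $ a)"
        using Q_proj_eq_axisD[of "u t - \<gamma> *\<^sub>R d t" a k] a active[OF k]
        by (simp add: v_def k axis_def)
      then have "d t $ a \<le> - (1 / \<gamma>)" using \<open>\<gamma> > 0\<close> by (simp add: field_simps)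
      also have "\<dots> \<le> - c" using \<open>\<gamma> > 0\<close> \<open>\<gamma> < \<gamma>0 + 1\<close> by (simp add: c_def frac_le)
      finally show ?thesis by (simp only: d_diff a)
    qed
    from perturb[OF Q m(2)[unfolded m_def] this]
    obtain y where y: "is_trajectory T x0 f (v \<gamma>) y"
      and le: "cost T l (y, v \<gamma>) - cost T l (x, u) \<le> - c * m \<gamma> + C * (m \<gamma>)\<^sup>2"
      by (auto simp: m_def)
    have "C * m \<gamma> \<le> (C + 1) * m \<gamma>" using m(1) by (simp add: distrib_right)
    also have "\<dots> < c" using m(3) \<open>C \<ge> 0\<close> by (simp add: field_simps)
    finally have "m \<gamma> * (C * m \<gamma> - c) < 0" using m(1) by (intro mult_pos_neg) auto
    then have cost_less: "cost T l (y, v \<gamma>) < cost T l (x, u)"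
      using le by (simp add: power2_eq_square algebra_simps)
    obtain z where
      z: "P_proj T x0 f (x, \<lambda>t. u t - \<gamma> *\<^sub>R d t) = (z, v \<gamma>)" "is_trajectory T x0 f (v \<gamma>) z"
      "\<And>t. t \<in> {0..T} \<Longrightarrow> z t = y t"
      unfolding v_def[abs_def]
      by (rule P_proj_trajectory[where f = f, OF f Q[unfolded v_def[abs_def]] y[unfolded v_def[abs_def]]]) blast
    have "J \<gamma> = cost T l (y, v \<gamma>)"
      unfolding assms(15) z(1) by (rule cost_cong[OF z(3)])
    with cost_less have "J \<gamma> < J 0" by (simp add: J0)
    moreover have "(z, v \<gamma>) \<in> feasible_set T x0 f" by (rule feasible_set_step_on[OF Q z(2)])
    moreover have "(\<lambda>t. u t - \<gamma> *\<^sub>R d t) absolutely_integrable_on {0..T}"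
      by (intro set_integral_diff absolutely_integrable_scaleR_left u_int d_int)
    then have "(\<lambda>t. u t - \<gamma> *\<^sub>R d t) \<in> R_set T"
      using step_on_Omega[OF Q] by (simp add: R_set_def v_def[abs_def])
    ultimately show ?thesis by (simp add: z(1))
  qed
  ultimately show ?thesis by blast
qed

end
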